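(* Let $n\ge0$ and $d\ge1$ be integers, $F_{n,d}(z)=\int_0^z t^n e^{-t^d/d}\,dt$, $\omega_j=e^{2\pi i j/d}$ and $W_j=\int_0^{+\infty\cdot\omega_j}t^ne^{-t^d/d}\,dt$ (integral along the ray from $0$ in the direction $\omega_j$). For $j=1,\dots,d$, for all $z\ne0$ in the sector $\left|\arg z-\frac{2j\pi}{d}\right|<\frac{\pi}{d}$, the function $F_{n,d}$ has the convergent continued fraction representation $$F_{n,d}(z)=W_j-z^ne^{-z^d/d}\cdot\cfrac{1}{z^{d-1}+\cfrac{(d-1)-n}{z+\cfrac{d}{z^{d-1}+\cfrac{(2d-1)-n}{z+\cfrac{2d}{z^{d-1}+\cfrac{(3d-1)-n}{z+\cfrac{3d}{z^{d-1}+\cdots}}}}}}}$$ $$\phantom{F_{n,d}(z)}=W_j-z^{n+1}e^{-z^d/d}\cdot\cfrac{1}{z^{d}+\cfrac{(d-1)-n}{1+\cfrac{d}{z^{d}+\cfrac{(2d-1)-n}{1+\cfrac{2d}{z^{d}+\cfrac{(3d-1)-n}{1+\cfrac{3d}{z^{d}+\cdots}}}}}}}$$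
   Context: The pattern of the first continued fraction is: partial denominators alternate $z^{d-1},z,z^{d-1},z,\dots$, the partial numerators after the initial $1$ are $(d-1)-n,\ d,\ (2d-1)-n,\ 2d,\ \dots,\ (md-1)-n,\ md,\dots$; the second has the same numerators and partial denominators $z^d,1,z^d,1,\dots$. The continued fraction terminates if a partial numerator vanishes. In the paper's terms, $W_j=\pi(w_j^* )$ is the projection of the $j$-th infinite ramification point of the log-Riemann surface uniformized by $F_{n,d}$. *)

theory Defs
  imports "HOL-Complex_Analysis.Complex_Analysis"
begin

text \<open>
  Continued fractions \<open>a 1 / (b 1 + a 2 / (b 2 + a 3 / (b 3 + \<dots>)))\<close>, with partial numerators
  \<open>a m\<close> and partial denominators \<open>b m\<close> for \<open>m \<ge> 1\<close>; the entries at \<open>m = 0\<close> are never used.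
  The approximants are formed by the fundamental recurrence and not by nested
  division, so that a vanishing intermediate denominator is not distorted by \<open>x / 0 = 0\<close>.
\<close>

fun cf_A :: "(nat \<Rightarrow> complex) \<Rightarrow> (nat \<Rightarrow> complex) \<Rightarrow> nat \<Rightarrow> complex" where
  "cf_A a b 0 = 0"
| "cf_A a b (Suc 0) = a 1"
| "cf_A a b (Suc (Suc m)) = b (Suc (Suc m)) * cf_A a b (Suc m) + a (Suc (Suc m)) * cf_A a b m"

fun cf_B :: "(nat \<Rightarrow> complex) \<Rightarrow> (nat \<Rightarrow> complex) \<Rightarrow> nat \<Rightarrow> complex" where
  "cf_B a b 0 = 1"
| "cf_B a b (Suc 0) = b 1"
| "cf_B a b (Suc (Suc m)) = b (Suc (Suc m)) * cf_B a b (Suc m) + a (Suc (Suc m)) * cf_B a b m"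

text \<open>
  If some partial numerator vanishes, the fraction terminates: with \<open>a (Suc M)\<close> the first
  vanishing one, its value is the \<open>M\<close>-th approximant, which has to be finite. Otherwise
  convergence is meant in the classical sense: all but finitely many approximants are
  finite, and they tend to a finite limit.
\<close>

definition cf_terminates :: "(nat \<Rightarrow> complex) \<Rightarrow> bool" where
  "cf_terminates a \<longleftrightarrow> (\<exists>M. a (Suc M) = 0)"

definition cf_has_value :: "(nat \<Rightarrow> complex) \<Rightarrow> (nat \<Rightarrow> complex) \<Rightarrow> complex \<Rightarrow> bool" where
  "cf_has_value a b v \<longleftrightarrow>
     (if cf_terminates a
      then let M = (LEAST M. a (Suc M) = 0) in cf_B a b M \<noteq> 0 \<and> v = cf_A a b M / cf_B a b M
      else (\<forall>\<^sub>F m in sequentially. cf_B a b m \<noteq> 0) \<and>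
           (\<lambda>m. cf_A a b m / cf_B a b m) \<longlonglongrightarrow> v)"

definition cf_convergent :: "(nat \<Rightarrow> complex) \<Rightarrow> (nat \<Rightarrow> complex) \<Rightarrow> bool" where
  "cf_convergent a b \<longleftrightarrow> (\<exists>v. cf_has_value a b v)"

definition cf_value :: "(nat \<Rightarrow> complex) \<Rightarrow> (nat \<Rightarrow> complex) \<Rightarrow> complex" where
  "cf_value a b = (THE v. cf_has_value a b v)"

definition integrand :: "nat \<Rightarrow> nat \<Rightarrow> complex \<Rightarrow> complex" where
  "integrand n d t = t ^ n * exp (- (t ^ d) / of_nat d)"

text \<open>The integrand is entire, so the straight segment stands for any path from \<open>0\<close> to \<open>z\<close>.\<close>

definition F :: "nat \<Rightarrow> nat \<Rightarrow> complex \<Rightarrow> complex" where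
  "F n d z = contour_integral (linepath 0 z) (integrand n d)"

definition omega :: "nat \<Rightarrow> nat \<Rightarrow> complex" where
  "omega d j = exp (2 * of_real pi * \<i> * of_nat j / of_nat d)"

definition W :: "nat \<Rightarrow> nat \<Rightarrow> nat \<Rightarrow> complex" where
  "W n d j =
     Lim at_top (\<lambda>R::real. contour_integral (linepath 0 (of_real R * omega d j)) (integrand n d))"

text \<open>
  The argument is multivalued: the sector consists of the \<open>z \<noteq> 0\<close> having some argument in the
  stated range. With the principal value \<open>Arg\<close> in \<open>{-pi<..pi}\<close>, sectors such as \<open>j = d\<close> would be wrong.
\<close>

definition sector :: "nat \<Rightarrow> nat \<Rightarrow> complex set" where
  "sector d j =
     {z. z \<noteq> 0 \<and> (\<exists>\<theta>. is_Arg z \<theta> \<and> \<bar>\<theta> - 2 * real j * pi / real d\<bar> < pi / real d)}"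

text \<open>Partial numerators \<open>1, (d-1)-n, d, (2d-1)-n, 2d, (3d-1)-n, 3d, \<dots>\<close> at \<open>m = 1, 2, 3, \<dots>\<close>.\<close>

definition pnum :: "nat \<Rightarrow> nat \<Rightarrow> nat \<Rightarrow> complex" where
  "pnum n d m =
     (if m = 1 then 1
      else if even m then of_nat (m div 2 * d) - 1 - of_nat n
      else of_nat (m div 2 * d))"

definition pden1 :: "nat \<Rightarrow> complex \<Rightarrow> nat \<Rightarrow> complex" where
  "pden1 d z m = (if odd m then z ^ (d - 1) else z)"

definition pden2 :: "nat \<Rightarrow> complex \<Rightarrow> nat \<Rightarrow> complex" where
  "pden2 d z m = (if odd m then z ^ d else 1)"

end

theory Submission
  imports Defs
begin

text \<open>
  Write \<open>f m = cf_A m - v * cf_B m\<close> for the candidate value \<open>v\<close>. The sequence \<open>f\<close> solves the same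
  three-term recurrence as numerators and denominators, and a fraction that does not terminate
  converges to \<open>v\<close> if \<open>cf_B m\<close> is eventually nonzero and \<open>f m / cf_B m\<close> tends to \<open>0\<close>, that is, if \<open>f\<close>
  is a minimal solution (Pincherle).

  A rotation reduces the claim to the sector around the positive real axis. There
  \<open>w = z powr (d / 2)\<close> runs through the right half-plane, and an equivalence transformation turns
  both fractions into the one with the constant partial denominator \<open>w\<close> (\<open>cf_rescale\<close>).

  On the positive real ray the \<open>f m\<close> are, up to explicit factors, iterated integrals of the
  integrand over \<open>{y..}\<close>. Their recurrence is integration by parts (\<open>ray_err_eq\<close>), and they are
  positive (\<open>tail_pos\<close>), so \<open>f\<close> alternates in sign once the partial numerators are positive.
  The partial numerators grow only linearly, and
  \<open>alternating_solution_over_positive_tendsto_0\<close> gives minimality there.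

  For complex \<open>w\<close>, a tail of the fraction with positive partial numerators has all its approximants
  bounded by a constant over \<open>Re w\<close> (\<open>cf_half_plane\<close>). Vitali's theorem then carries the
  convergence from the ray to the half-plane, and the first finitely many partial numerators are
  put back by a Casoratian argument (\<open>pincherle_half_plane\<close>).

  If a partial numerator vanishes, so does the remainder at the last index on the ray
  (\<open>tail_terminates\<close>), and analytic continuation gives the value of the finite fraction.
\<close>

section \<open>Recurrences and equivalence transformations\<close>

text \<open>
  Numerators and denominators solve the same linear recurrence, so from index \<open>Suc p\<close> on both
  are combinations, with the values at \<open>p\<close> and \<open>Suc p\<close> as coefficients, of the solutions that
  belong to the tail of the fraction.
\<close>

lemma cf_splice:
  fixes a b :: "nat \<Rightarrow> complex" and p :: nat
  defines "a' \<equiv> \<lambda>i. a (Suc p + i)" and "b' \<equiv> \<lambda>i. b (Suc p + i)"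
  shows "cf_A a b (Suc p + i) = cf_A a b (Suc p) * cf_B a' b' i + cf_A a b p * cf_A a' b' i"
    and "cf_B a b (Suc p + i) = cf_B a b (Suc p) * cf_B a' b' i + cf_B a b p * cf_A a' b' i"
proof (induction i rule: induct_nat_012)
  case (ge2 i)
  {
    case 1 show ?case using ge2 by (simp add: a'_def b'_def algebra_simps)
  next
    case 2 show ?case using ge2 by (simp add: a'_def b'_def algebra_simps)
  }
qed (simp_all add: a'_def b'_def)

lemma cf_casoratian:
  "cf_A a b (Suc m) * cf_B a b m - cf_A a b m * cf_B a b (Suc m) = (-1) ^ m * (\<Prod>i=1..Suc m. a i)"
proof (induction m)
  case (Suc m)
  have "cf_A a b (Suc (Suc m)) * cf_B a b (Suc m) - cf_A a b (Suc m) * cf_B a b (Suc (Suc m))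
      = - a (Suc (Suc m)) * (cf_A a b (Suc m) * cf_B a b m - cf_A a b m * cf_B a b (Suc m))"
    by (simp add: algebra_simps)
  also have "\<dots> = - a (Suc (Suc m)) * ((-1) ^ m * (\<Prod>i=1..Suc m. a i))"
    by (simp only: Suc.IH)
  also have "\<dots> = (-1) ^ Suc m * (\<Prod>i=1..Suc (Suc m). a i)"
    by (simp add: prod.nat_ivl_Suc')
  finally show ?case .
qed simp

text \<open>
  An equivalence transformation of the fraction. The products \<open>c * (1 / c)\<close> of neighbouring scaling
  factors are \<open>1\<close>, so the partial numerators stay as they are; only the factor \<open>c\<close> of the first
  partial denominator shows in the approximants. Both fractions of the theorem arise in this way
  from the fraction with constant partial denominator \<open>w\<close>.
\<close>

lemma cf_rescale:
  fixes c w :: complex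
  assumes "c \<noteq> 0"
  defines "b \<equiv> \<lambda>m. if odd m then c * w else w / c"
  shows "cf_A a b m = (if odd m then 1 else 1 / c) * cf_A a (\<lambda>_. w) m"
    and "cf_B a b m = (if odd m then c else 1) * cf_B a (\<lambda>_. w) m"
proof (induction m rule: induct_nat_012)
  case (ge2 i)
  {
    case 1 show ?case using ge2 assms by (auto simp: b_def field_simps)
  next
    case 2 show ?case using ge2 assms by (auto simp: b_def field_simps)
  }
qed (use assms in \<open>simp_all add: b_def\<close>)

lemma cf_has_value_rescale:
  assumes "c \<noteq> 0" "cf_has_value a (\<lambda>_. w) v"
  shows "cf_has_value a (\<lambda>m. if odd m then c * w else w / c) (v / c)"
proof -
  let ?b = "\<lambda>m. if odd m then c * w else w / c"
  have nz: "cf_B a ?b m = 0 \<longleftrightarrow> cf_B a (\<lambda>_. w) m = 0" for m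
    using assms(1) by (simp add: cf_rescale(2))
  have quot: "cf_A a ?b m / cf_B a ?b m = cf_A a (\<lambda>_. w) m / cf_B a (\<lambda>_. w) m / c" for m
    using assms(1) by (simp add: cf_rescale)
  show ?thesis
    using assms unfolding cf_has_value_def nz quot
    by (auto simp: Let_def simp del: divide_divide_eq_left intro!: tendsto_divide[OF _ tendsto_const])
qed

lemma cf_has_value_unique:
  assumes "cf_has_value a b v" "cf_has_value a b v'"
  shows "v = v'"
  using assms by (auto simp: cf_has_value_def Let_def split: if_splits intro: LIMSEQ_unique)

lemma cf_value_eq: "cf_has_value a b v \<Longrightarrow> cf_value a b = v"
  unfolding cf_value_def using cf_has_value_unique by blast

section \<open>Fractions with positive partial numerators\<close>

text \<open>
  The right half-plane is a value region: adding \<open>w\<close> and forming \<open>\<alpha> / t\<close> with \<open>\<alpha> > 0\<close> both map it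
  into itself. The real part of the denominator \<open>w + \<dots>\<close> never drops below \<open>Re w\<close>, which gives
  a bound that does not depend on the index of the approximant; this is the normality needed for a
  compactness argument.
\<close>

lemma cf_half_plane:
  fixes \<alpha> :: "nat \<Rightarrow> real"
  assumes "Re w > 0" "\<And>i. i \<ge> 1 \<Longrightarrow> \<alpha> i > 0"
  defines "a \<equiv> \<lambda>i. complex_of_real (\<alpha> i)"
  shows "cf_B a (\<lambda>_. w) m \<noteq> 0 \<and> Re (cf_A a (\<lambda>_. w) m / cf_B a (\<lambda>_. w) m) \<ge> 0
       \<and> norm (cf_A a (\<lambda>_. w) m / cf_B a (\<lambda>_. w) m) \<le> \<alpha> 1 / Re w"
  using assms(2) unfolding a_def
proof (induction m arbitrary: \<alpha>)
  case 0
  then show ?case using assms(1) by (simp add: less_imp_le)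
next
  case (Suc m)
  let ?a = "\<lambda>i. complex_of_real (\<alpha> i)"
  let ?A = "cf_A (\<lambda>i. complex_of_real (\<alpha> (Suc i))) (\<lambda>_. w) m"
  let ?B = "cf_B (\<lambda>i. complex_of_real (\<alpha> (Suc i))) (\<lambda>_. w) m"
  define t where "t = w + ?A / ?B"
  have IH: "?B \<noteq> 0" "Re (?A / ?B) \<ge> 0"
    using Suc.IH[of "\<lambda>i. \<alpha> (Suc i)"] Suc.prems by auto
  have t: "Re t \<ge> Re w" using IH by (simp add: t_def)
  hence t0: "t \<noteq> 0" "Re t > 0" using assms(1) by auto
  have A: "cf_A ?a (\<lambda>_. w) (Suc m) = \<alpha> 1 * ?B"
    using cf_splice(1)[of ?a "\<lambda>_. w" 0 m] by simp
  have B: "cf_B ?a (\<lambda>_. w) (Suc m) = t * ?B"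
    using cf_splice(2)[of ?a "\<lambda>_. w" 0 m] IH by (simp add: t_def field_simps)
  have quot: "cf_A ?a (\<lambda>_. w) (Suc m) / cf_B ?a (\<lambda>_. w) (Suc m) = \<alpha> 1 / t"
    using IH t0 unfolding A B by simp
  have "Re w \<le> norm t" using t complex_Re_le_cmod[of t] by linarith
  hence "norm (\<alpha> 1 / t) \<le> \<alpha> 1 / Re w"
    using Suc.prems[of 1] assms(1) by (auto simp: norm_divide intro!: divide_left_mono mult_pos_pos)
  moreover have "Re (\<alpha> 1 / t) \<ge> 0"
    using Suc.prems[of 1] t0 by (simp add: Re_divide)
  ultimately show ?case using IH t0 unfolding quot by (simp add: B)
qed

lemma cf_B_real_pos:
  fixes \<alpha> :: "nat \<Rightarrow> real"
  assumes "u > 0" "\<And>i. i \<ge> 1 \<Longrightarrow> \<alpha> i > 0"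
  defines "a \<equiv> \<lambda>i. complex_of_real (\<alpha> i)"
  shows "\<exists>r>0. cf_B a (\<lambda>_. of_real u) m = of_real r"
proof (induction m rule: induct_nat_012)
  case 0 show ?case by (auto intro!: exI[of _ 1])
next
  case 1 show ?case using assms(1) by (auto intro!: exI[of _ u])
next
  case (ge2 m)
  then obtain r s where rs: "r > 0" "s > 0" "cf_B a (\<lambda>_. of_real u) m = of_real r"
    "cf_B a (\<lambda>_. of_real u) (Suc m) = of_real s" by blast
  show ?case
    using rs assms(1) assms(2)[of "Suc (Suc m)"]
    by (intro exI[of _ "u * s + \<alpha> (Suc (Suc m)) * r"]) (simp add: a_def add_pos_pos)
qed

text \<open>
  An elementary form of Pincherle's criterion. In an alternating solution the two terms of the
  recurrence have opposite signs, so two steps multiply its size by at most \<open>\<alpha>\<close>; in a positive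
  solution two steps multiply by at least \<open>\<alpha> + u\<^sup>2\<close>. As \<open>\<alpha>\<close> grows at most linearly, the product of
  the factors \<open>1 + u\<^sup>2 / \<alpha>\<close> diverges like the harmonic series.
\<close>

lemma alternating_solution_over_positive_tendsto_0:
  fixes e \<beta> \<alpha> :: "nat \<Rightarrow> real"
  assumes u: "u > 0" and C: "C > 0"
    and \<alpha>: "\<And>m. \<alpha> (m + 2) > 0" "\<And>m. \<alpha> (m + 2) \<le> C * (real m + 1)"
    and e: "\<And>m. e (m + 2) = u * e (m + 1) + \<alpha> (m + 2) * e m" "\<And>m. e m * e (Suc m) < 0"
    and \<beta>: "\<And>m. \<beta> (m + 2) = u * \<beta> (m + 1) + \<alpha> (m + 2) * \<beta> m" "\<And>m. \<beta> m > 0"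
      "\<beta> 1 \<ge> u * \<beta> 0"
  shows "(\<lambda>m. e m / \<beta> m) \<longlonglongrightarrow> 0"
proof -
  have \<beta>1: "\<beta> (m + 1) \<ge> u * \<beta> m" for m
  proof (cases m)
    case 0 thus ?thesis using \<beta>(3) by simp
  next
    case (Suc k)
    thus ?thesis using \<beta>(1)[of k] \<alpha>(1)[of k] \<beta>(2)[of k] by (simp add: less_imp_le)
  qed
  have \<beta>2: "\<beta> (m + 2) \<ge> (\<alpha> (m + 2) + u\<^sup>2) * \<beta> m" for m
  proof -
    have "u * (u * \<beta> m) \<le> u * \<beta> (m + 1)" using \<beta>1[of m] u by (intro mult_left_mono) auto
    thus ?thesis using \<beta>(1)[of m] by (simp add: algebra_simps power2_eq_square)
  qed
  have e2: "\<bar>e (m + 2)\<bar> \<le> \<alpha> (m + 2) * \<bar>e m\<bar>" for m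
  proof -
    have 1: "e m * e (Suc m) < 0" "e (Suc m) * e (m + 2) < 0" using e(2)[of m] e(2)[of "Suc m"] by auto
    have 2: "e (m + 2) = u * e (Suc m) + \<alpha> (m + 2) * e m" using e(1)[of m] by simp
    show ?thesis
    proof (cases "e m > 0")
      case True
      hence "e (Suc m) < 0" "e (m + 2) > 0" using 1 by (auto simp: mult_less_0_iff)
      moreover have "u * e (Suc m) \<le> 0" using calculation u by (simp add: mult_le_0_iff)
      ultimately show ?thesis using True 2 by simp
    next
      case False
      hence "e m < 0" "e (Suc m) > 0" "e (m + 2) < 0" using 1 by (auto simp: mult_less_0_iff)
      moreover have "u * e (Suc m) \<ge> 0" using calculation u by simp
      ultimately show ?thesis using 2 by simp
    qed
  qed
  \<comment> \<open>With this constant \<open>2 * \<kappa> / (m + 1) \<le> u\<^sup>2 / \<alpha> (m + 2)\<close>, which pays for the two new terms of \<open>harm (m + 2)\<close>.\<close>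
  define \<kappa> where "\<kappa> = u\<^sup>2 / (2 * C)"
  have \<kappa>: "\<kappa> > 0" using u C by (simp add: \<kappa>_def)
  define r where "r m = \<bar>e m\<bar> / \<beta> m" for m
  have r0: "r m \<ge> 0" for m using \<beta>(2)[of m] by (simp add: r_def)
  define M where "M = max (r 0 * (1 + \<kappa> * harm 0)) (r 1 * (1 + \<kappa> * harm 1))"
  have bound: "r m * (1 + \<kappa> * harm m) \<le> M" for m
  proof (induction m rule: induct_nat_012)
    case (ge2 m)
    let ?\<alpha> = "\<alpha> (m + 2)"
    have pos: "?\<alpha> > 0" "?\<alpha> + u\<^sup>2 > 0" using \<alpha>(1)[of m] u by (auto simp: add_pos_pos)
    have h0: "harm m \<ge> (0::real)" by (rule harm_nonneg)
    have "harm (m + 2) = (harm m :: real) + inverse (real m + 1) + inverse (real m + 2)"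
      using harm_Suc[of m, where ?'a = real] harm_Suc[of "Suc m", where ?'a = real] by (simp add: add_ac)
    also have "inverse (real m + 2) \<le> inverse (real m + 1)" by (intro le_imp_inverse_le) auto
    finally have "harm (m + 2) \<le> harm m + 2 / (real m + 1)"
      by (simp add: divide_inverse)
    hence "1 + \<kappa> * harm (m + 2) \<le> 1 + \<kappa> * (harm m + 2 / (real m + 1))"
      using \<kappa> by simp
    also have "\<dots> = (1 + \<kappa> * harm m) + u\<^sup>2 / (C * (real m + 1))"
    proof -
      have "\<kappa> * (2 / (real m + 1)) = u\<^sup>2 / (C * (real m + 1))" by (simp add: \<kappa>_def)
      thus ?thesis by (simp only: distrib_left add.assoc)
    qed
    also have "u\<^sup>2 / (C * (real m + 1)) \<le> u\<^sup>2 / ?\<alpha>"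
      using \<alpha>(2)[of m] pos C by (intro divide_left_mono) (auto intro!: mult_pos_pos)
    also have "u\<^sup>2 / ?\<alpha> \<le> (1 + \<kappa> * harm m) * (u\<^sup>2 / ?\<alpha>)"
      using mult_right_mono[of 1 "1 + \<kappa> * harm m" "u\<^sup>2 / ?\<alpha>"] \<kappa> h0 pos by simp
    finally have h: "1 + \<kappa> * harm (m + 2) \<le> (1 + \<kappa> * harm m) * ((?\<alpha> + u\<^sup>2) / ?\<alpha>)"
      using pos by (simp add: field_simps)
    have "r (m + 2) \<le> (?\<alpha> * \<bar>e m\<bar>) / ((?\<alpha> + u\<^sup>2) * \<beta> m)"
      unfolding r_def using e2[of m] \<beta>2[of m] \<beta>(2)[of m] pos
      by (intro frac_le) (auto intro!: mult_pos_pos mult_nonneg_nonneg)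
    also have "\<dots> = r m * (?\<alpha> / (?\<alpha> + u\<^sup>2))" by (simp add: r_def mult_ac)
    finally have "r (m + 2) * (1 + \<kappa> * harm (m + 2))
        \<le> (r m * (?\<alpha> / (?\<alpha> + u\<^sup>2))) * ((1 + \<kappa> * harm m) * ((?\<alpha> + u\<^sup>2) / ?\<alpha>))"
      using h r0[of m] \<kappa> harm_nonneg[of "m + 2", where ?'a = real] pos
      by (intro mult_mono) (auto intro!: mult_nonneg_nonneg add_nonneg_nonneg)
    also have "\<dots> = (r m * (1 + \<kappa> * harm m)) * ((?\<alpha> / (?\<alpha> + u\<^sup>2)) * ((?\<alpha> + u\<^sup>2) / ?\<alpha>))"
      by (simp only: mult_ac)
    also have "(?\<alpha> / (?\<alpha> + u\<^sup>2)) * ((?\<alpha> + u\<^sup>2) / ?\<alpha>) = 1" using pos by simp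
    also have "(r m * (1 + \<kappa> * harm m)) * 1 = r m * (1 + \<kappa> * harm m)" by simp
    also have "\<dots> \<le> M" by (rule ge2(1))
    finally show ?case by simp
  qed (simp_all add: M_def)
  have h: "1 + \<kappa> * harm m > 0" for m
    using \<kappa> harm_nonneg[of m, where ?'a = real] by (intro add_pos_nonneg) auto
  have "(\<lambda>m. M / (1 + \<kappa> * harm m)) \<longlonglongrightarrow> 0"
    by (intro tendsto_divide_0[OF tendsto_const] filterlim_at_top_imp_at_infinity
        filterlim_tendsto_add_at_top[OF tendsto_const]
        filterlim_tendsto_pos_mult_at_top[OF tendsto_const \<kappa>] harm_at_top)
  moreover have "\<forall>\<^sub>F m in sequentially. norm (e m / \<beta> m) \<le> M / (1 + \<kappa> * harm m)"
  proof (intro always_eventually allI)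
    fix m
    have "norm (e m / \<beta> m) = r m" using \<beta>(2)[of m] by (simp add: r_def)
    thus "norm (e m / \<beta> m) \<le> M / (1 + \<kappa> * harm m)"
      using bound[of m] h[of m] by (simp add: pos_le_divide_eq)
  qed
  ultimately show ?thesis by (rule Lim_null_comparison[rotated])
qed

text \<open>
  A form of Vitali's theorem: if convergence to \<open>0\<close> failed at \<open>z\<close>, some subsequence would stay away
  from \<open>0\<close> there, but by Montel's theorem a further subsequence has a holomorphic limit, which
  vanishes on \<open>U\<close> and therefore everywhere.
\<close>

lemma vitali_tendsto_0:
  fixes E :: "nat \<Rightarrow> complex \<Rightarrow> complex"
  assumes S: "open S" "connected S" and hol: "\<And>m. E m holomorphic_on S"
    and cont: "continuous_on S M" and bound: "\<And>m z. z \<in> S \<Longrightarrow> norm (E m z) \<le> M z"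
    and U: "U \<subseteq> S" "\<xi> \<in> S" "\<xi> islimpt U" "\<And>z. z \<in> U \<Longrightarrow> (\<lambda>m. E m z) \<longlonglongrightarrow> 0"
    and z: "z \<in> S"
  shows "(\<lambda>m. E m z) \<longlonglongrightarrow> 0"
proof (rule ccontr)
  assume "\<not> ?thesis"
  then obtain \<epsilon> where \<epsilon>: "\<epsilon> > 0" and "\<not> (\<exists>no. \<forall>m\<ge>no. norm (E m z) < \<epsilon>)"
    unfolding LIMSEQ_iff by auto
  hence "infinite {m. norm (E m z) \<ge> \<epsilon>}"
    unfolding infinite_nat_iff_unbounded_le by (auto simp: not_less)
  from infinite_enumerate[OF this] obtain s :: "nat \<Rightarrow> nat"
    where s: "strict_mono s" "\<And>m. norm (E (s m) z) \<ge> \<epsilon>" by auto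
  have bdd: "\<exists>B. \<forall>h\<in>range E. \<forall>x\<in>K. norm (h x) \<le> B" if "compact K" "K \<subseteq> S" for K
  proof -
    have "compact (M ` K)"
      using that cont by (intro compact_continuous_image) (auto intro: continuous_on_subset)
    then obtain B where B: "\<And>x. x \<in> K \<Longrightarrow> norm (M x) \<le> B"
      using compact_imp_bounded bounded_iff by (metis imageI)
    have "norm (E m x) \<le> B" if "x \<in> K" for m x
      using bound[of x m] B[OF that] that \<open>K \<subseteq> S\<close> by force
    thus ?thesis by auto
  qed
  obtain g r where g: "g holomorphic_on S" "strict_mono (r :: nat \<Rightarrow> nat)"
      "\<And>x. x \<in> S \<Longrightarrow> (\<lambda>m. E (s (r m)) x) \<longlonglongrightarrow> g x"
    by (rule Montel[OF S(1) _ bdd, of "\<lambda>m. E (s m)"]) (use hol in auto)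
  have "g x = 0" if "x \<in> U" for x
  proof (rule LIMSEQ_unique[OF g(3)])
    have "((\<lambda>m. E m x) \<circ> (s \<circ> r)) \<longlonglongrightarrow> 0"
      by (intro LIMSEQ_subseq_LIMSEQ U(4) that strict_mono_o s g)
    thus "(\<lambda>m. E (s (r m)) x) \<longlonglongrightarrow> 0" by (simp add: o_def)
  qed (use that U in auto)
  hence "g z = 0" by (rule analytic_continuation[OF g(1) S U(1-3)]) (use z in auto)
  hence "(\<lambda>m. E (s (r m)) z) \<longlonglongrightarrow> 0" using g(3)[OF z] by simp
  hence "\<forall>\<^sub>F m in sequentially. norm (E (s (r m)) z) < \<epsilon>"
    using \<epsilon> by (simp add: tendsto_iff)
  then obtain m where "norm (E (s (r m)) z) < \<epsilon>"
    by (auto simp: eventually_sequentially)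
  thus False using s(2)[of "r m"] by linarith
qed

section \<open>The remainders on the positive real ray\<close>

text \<open>
  The partial numerator at the even index \<open>2 * k + 2\<close>. In terms of the parameter
  \<open>\<alpha> = 1 - (n + 1) / d\<close> of the incomplete gamma function it is \<open>d * (\<alpha> + k)\<close>.
\<close>

definition hcoef :: "nat \<Rightarrow> nat \<Rightarrow> nat \<Rightarrow> real" where
  "hcoef n d k = real (Suc k * d) - 1 - real n"

text \<open>
  Let \<open>G y\<close> be the integral of \<open>t ^ n * exp (- t ^ d / d)\<close> over \<open>{y..}\<close>, and put \<open>x = y ^ d / d\<close>,
  \<open>\<alpha> = 1 - (n + 1) / d\<close>. As long as no \<open>hcoef\<close> that was divided by vanishes, and up to the
  factor \<open>d powr (- \<alpha>)\<close>, \<open>tailH\<close> is the integral of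
  \<open>exp (- s) * (s - x) ^ k * s powr (- \<alpha> - k)\<close> over \<open>s \<ge> x\<close>, and for \<open>k \<ge> 1\<close> \<open>tailU\<close> is the
  integral of \<open>k * exp (- s) * (s - x) ^ (k - 1) * s powr (- \<alpha> - k)\<close>. The recursion is integration
  by parts for these integrals. The recursive form is used, since it makes the link to the
  continued fraction an algebraic identity; positivity, which the integrals would show at a
  glance, is recovered from the derivatives and the decay at infinity.
\<close>

fun tailH :: "nat \<Rightarrow> nat \<Rightarrow> (real \<Rightarrow> real) \<Rightarrow> nat \<Rightarrow> real \<Rightarrow> real"
  and tailU :: "nat \<Rightarrow> nat \<Rightarrow> (real \<Rightarrow> real) \<Rightarrow> nat \<Rightarrow> real \<Rightarrow> real" where
  "tailH n d G 0 y = G y"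
| "tailU n d G 0 y = y ^ (n + 1) / y ^ d * exp (- (y ^ d) / real d)"
| "tailH n d G (Suc k) y
     = tailH n d G k y - y ^ d * ((tailU n d G k y - tailH n d G k y) / hcoef n d k)"
| "tailU n d G (Suc k) y
     = real (Suc k * d) * ((tailU n d G k y - tailH n d G k y) / hcoef n d k)"

lemma power_exp_tendsto_0:
  fixes c :: real
  assumes "c > 0"
  shows "((\<lambda>y. y ^ p * exp (- (c * y))) \<longlongrightarrow> 0) at_top"
proof -
  have "((\<lambda>y. (c * y) ^ p / exp (c * y) / c ^ p) \<longlongrightarrow> 0 / c ^ p) at_top"
    using assms
    by (intro tendsto_divide[OF filterlim_compose[OF tendsto_power_div_exp_0]] tendsto_const
        filterlim_tendsto_pos_mult_at_top[OF tendsto_const assms] filterlim_ident) auto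
  also have "(\<lambda>y. (c * y) ^ p / exp (c * y) / c ^ p) = (\<lambda>y. y ^ p * exp (- (c * y)))"
    using assms by (auto simp: power_mult_distrib exp_minus field_simps)
  finally show ?thesis by simp
qed

context
  fixes n d :: nat and G :: "real \<Rightarrow> real"
  assumes d: "d \<ge> 1"
    and G_deriv: "\<And>y. y > 0 \<Longrightarrow> (G has_real_derivative - (y ^ n * exp (- (y ^ d) / real d))) (at y)"
    and G_decay: "\<And>p. ((\<lambda>y. y ^ p * G y) \<longlongrightarrow> 0) at_top"
begin

private abbreviation "H \<equiv> tailH n d G"
private abbreviation "U \<equiv> tailU n d G"
private abbreviation "c \<equiv> hcoef n d"

text \<open>
  Each step of the recursion multiplies by at most \<open>y ^ d\<close>. Decay against every power of \<open>y\<close>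
  survives this, mere convergence to \<open>0\<close> would not.
\<close>

lemma tail_decay: "((\<lambda>y. y ^ p * H k y) \<longlongrightarrow> 0) at_top \<and> ((\<lambda>y. y ^ p * U k y) \<longlongrightarrow> 0) at_top"
proof (induction k arbitrary: p)
  case 0
  have "((\<lambda>y::real. y ^ p * U 0 y) \<longlongrightarrow> 0) at_top"
  proof (rule Lim_null_comparison)
    show "((\<lambda>y::real. y ^ (p + (n + 1)) * exp (- (1 / real d * y))) \<longlongrightarrow> 0) at_top"
      using d by (intro power_exp_tendsto_0) simp
    show "\<forall>\<^sub>F y::real in at_top. norm (y ^ p * U 0 y) \<le> y ^ (p + (n + 1)) * exp (- (1 / real d * y))"
      using eventually_ge_at_top[of 1]
    proof eventually_elim
      case (elim y)
      have y: "y ^ d \<ge> y" "y ^ d \<ge> 1" using elim d power_increasing[of 1 d y] by auto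
      have "y ^ (n + 1) / y ^ d \<le> y ^ (n + 1)"
        using y elim by (simp add: field_simps)
      moreover have "exp (- (y ^ d) / real d) \<le> exp (- (1 / real d * y))"
        using y d by (simp add: field_simps)
      ultimately have "U 0 y \<le> y ^ (n + 1) * exp (- (1 / real d * y))"
        unfolding tailU.simps using elim by (intro mult_mono) auto
      hence "y ^ p * U 0 y \<le> y ^ p * (y ^ (n + 1) * exp (- (1 / real d * y)))"
        using elim by (intro mult_left_mono) auto
      moreover have "y ^ p * U 0 y \<ge> 0" using elim by simp
      ultimately show ?case by (simp add: power_add mult_ac)
    qed
  qed
  with G_decay show ?case by simp
next
  case (Suc k)
  have "((\<lambda>y. y ^ q * U k y - y ^ q * H k y) \<longlongrightarrow> 0 - 0) at_top" for q
    using Suc.IH by (intro tendsto_diff) auto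
  hence J: "((\<lambda>y. (y ^ q * U k y - y ^ q * H k y) * C) \<longlongrightarrow> 0) at_top" for q C
    by (simp add: tendsto_mult_left_zero)
  have "((\<lambda>y. y ^ p * H k y - (y ^ (p + d) * U k y - y ^ (p + d) * H k y) * (1 / c k)) \<longlongrightarrow> 0 - 0) at_top"
    by (intro tendsto_diff conjunct1[OF Suc.IH] J)
  moreover have "((\<lambda>y. (y ^ p * U k y - y ^ p * H k y) * (real (Suc k * d) / c k)) \<longlongrightarrow> 0) at_top"
    by (rule J)
  ultimately show ?case by (simp add: power_add algebra_simps diff_divide_distrib)
qed

text \<open>
  In terms of \<open>x = y ^ d / d\<close> these are the rules for differentiating the integrals
  under the integral sign. The second one is stated for the difference and not for its quotient by
  \<open>c k\<close>, so that it also covers the index at which \<open>c k\<close> vanishes and the fraction terminates.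
\<close>

lemma tail_deriv:
  assumes "y > 0" "\<And>i. i < k \<Longrightarrow> c i \<noteq> 0"
  shows "(H k has_real_derivative - (y ^ (d - 1) * U k y)) (at y)"
    and "((\<lambda>y. U k y - H k y) has_real_derivative
           (real (k * d) * (U k y - H k y) - c k * U k y) / y) (at y)"
proof -
  have yd: "y ^ d = y * y ^ (d - 1)" using d by (metis Suc_pred' le_eq_less_or_eq less_one not_less power_Suc zero_less_iff_neq_zero)
  have "(H k has_real_derivative - (y ^ (d - 1) * U k y)) (at y) \<and>
     ((\<lambda>y. U k y - H k y) has_real_derivative
           (real (k * d) * (U k y - H k y) - c k * U k y) / y) (at y)"
    using assms(2)
  proof (induction k)
    case 0
    have 1: "y ^ (d - 1) * U 0 y = y ^ n * exp (- (y ^ d) / real d)"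
      using assms(1) by (simp add: yd field_simps)
    have X: "((\<lambda>y. y ^ d) has_real_derivative real d * y ^ (d - 1)) (at y)"
      using DERIV_pow[of d y] by simp
    have N: "((\<lambda>y. y ^ (n + 1)) has_real_derivative (real n + 1) * y ^ n) (at y)"
      using DERIV_pow[of "n + 1" y] by (simp add: add.commute)
    have E: "((\<lambda>y. exp (- (y ^ d) / real d)) has_real_derivative
        exp (- (y ^ d) / real d) * (- (real d * y ^ (d - 1)) / real d)) (at y)"
      by (intro DERIV_chain2[OF DERIV_exp] DERIV_cdivide DERIV_minus X)
    have U0: "U 0 = (\<lambda>y. y ^ (n + 1) / y ^ d * exp (- (y ^ d) / real d))"
      by (rule ext) simp
    have "(U 0 has_real_derivative
        ((real n + 1) * y ^ n * y ^ d - y ^ (n + 1) * (real d * y ^ (d - 1))) / (y ^ d * y ^ d)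
          * exp (- (y ^ d) / real d)
        + exp (- (y ^ d) / real d) * (- (real d * y ^ (d - 1)) / real d) * (y ^ (n + 1) / y ^ d)) (at y)"
      unfolding U0 using assms(1) by (intro DERIV_mult DERIV_divide N X E) auto
    also have "((real n + 1) * y ^ n * y ^ d - y ^ (n + 1) * (real d * y ^ (d - 1))) / (y ^ d * y ^ d)
          * exp (- (y ^ d) / real d)
        + exp (- (y ^ d) / real d) * (- (real d * y ^ (d - 1)) / real d) * (y ^ (n + 1) / y ^ d)
      = ((real n + 1 - real d) / y - y ^ (d - 1)) * U 0 y"
      unfolding tailU.simps using assms(1) d by (simp add: yd field_simps)
    finally have "(U 0 has_real_derivative ((real n + 1 - real d) / y - y ^ (d - 1)) * U 0 y) (at y)" .
    from DERIV_diff[OF this G_deriv[OF assms(1)]]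
    have "((\<lambda>y. U 0 y - H 0 y) has_real_derivative
        ((real n + 1 - real d) / y - y ^ (d - 1)) * U 0 y + y ^ (d - 1) * U 0 y) (at y)"
      unfolding 1 by simp
    also have "((real n + 1 - real d) / y - y ^ (d - 1)) * U 0 y + y ^ (d - 1) * U 0 y
       = (real (0 * d) * (U 0 y - H 0 y) - c 0 * U 0 y) / y"
      using assms(1) by (simp add: hcoef_def field_simps)
    finally show ?case using G_deriv[OF assms(1)] 1 by simp
  next
    case (Suc k)
    let ?P = "U k y - H k y" and ?P' = "(real (k * d) * (U k y - H k y) - c k * U k y) / y"
    have ck: "c k \<noteq> 0" using Suc.prems by simp
    have h: "(H k has_real_derivative - (y ^ (d - 1) * U k y)) (at y)"
      and p: "((\<lambda>y. U k y - H k y) has_real_derivative ?P') (at y)"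
      using Suc by auto
    have X: "((\<lambda>y. y ^ d) has_real_derivative real d * y ^ (d - 1)) (at y)"
      using DERIV_pow[of d y] by simp
    have j: "((\<lambda>y. (U k y - H k y) / c k) has_real_derivative ?P' / c k) (at y)"
      by (rule DERIV_cdivide[OF p])
    have H_Suc: "H (Suc k) = (\<lambda>y. H k y - y ^ d * ((U k y - H k y) / c k))"
      and U_Suc: "U (Suc k) = (\<lambda>y. real (Suc k * d) * ((U k y - H k y) / c k))"
      by (rule ext, simp)+
    have H': "- (y ^ (d - 1) * U k y) - (real d * y ^ (d - 1) * (?P / c k) + ?P' / c k * y ^ d)
        = - (y ^ (d - 1) * U (Suc k) y)"
      using ck assms(1) by (simp add: yd field_simps)
    have h': "(H (Suc k) has_real_derivative - (y ^ (d - 1) * U (Suc k) y)) (at y)"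
      using DERIV_diff[OF h DERIV_mult[OF X j]] unfolding H' by (simp only: H_Suc)
    have u': "(U (Suc k) has_real_derivative real (Suc k * d) * (?P' / c k)) (at y)"
      using DERIV_cmult[OF j, of "real (Suc k * d)"] by (simp only: U_Suc)
    define Z where "Z = ?P / c k"
    have Uk: "U k y = c k * Z + H k y" using ck by (simp add: Z_def)
    have cS: "c (Suc k) = c k + real d" by (simp add: hcoef_def algebra_simps)
    have US: "U (Suc k) y = real (Suc k * d) * Z" and HS: "H (Suc k) y = H k y - y ^ d * Z"
      by (simp_all add: Z_def)
    have P'Z: "?P' / c k = (real (k * d) * Z - (c k * Z + H k y)) / y"
      using ck assms(1) by (simp add: Uk field_simps)
    have eq: "real (Suc k * d) * (?P' / c k) - - (y ^ (d - 1) * U (Suc k) y)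
        = (real (Suc k * d) * (U (Suc k) y - H (Suc k) y) - c (Suc k) * U (Suc k) y) / y"
      unfolding P'Z US HS cS yd using assms(1) by (simp add: field_simps)
    show ?case using h' DERIV_diff[OF u' h'] unfolding eq by (rule conjI)
  qed
  thus "(H k has_real_derivative - (y ^ (d - 1) * U k y)) (at y)"
    and "((\<lambda>y. U k y - H k y) has_real_derivative
           (real (k * d) * (U k y - H k y) - c k * U k y) / y) (at y)" by auto
qed

text \<open>
  Dividing by \<open>y ^ (k * d)\<close> turns the linear differential equation for \<open>U k - H k\<close> into a
  plain derivative, whose sign can be read off.
\<close>

lemma tail_quot:
  assumes "\<And>i. i < k \<Longrightarrow> c i \<noteq> 0"
  shows "y > 0 \<Longrightarrow> ((\<lambda>y. (U k y - H k y) / y ^ (k * d)) has_real_derivative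
           - (c k * U k y / y ^ (k * d + 1))) (at y)"
    and "((\<lambda>y. (U k y - H k y) / y ^ (k * d)) \<longlongrightarrow> 0) at_top"
proof -
  assume y: "y > 0"
  have "((\<lambda>y. (U k y - H k y) / y ^ (k * d)) has_real_derivative
     ((real (k * d) * (U k y - H k y) - c k * U k y) / y * y ^ (k * d)
       - (U k y - H k y) * (real (k * d) * y ^ (k * d - Suc 0))) / (y ^ (k * d) * y ^ (k * d))) (at y)"
    using y by (intro DERIV_divide tail_deriv(2) assms DERIV_pow) auto
  also have "real (k * d) * y ^ (k * d - Suc 0) = real (k * d) * y ^ (k * d) / y"
    using y by (cases "k * d") auto
  also have "((real (k * d) * (U k y - H k y) - c k * U k y) / y * y ^ (k * d)
       - (U k y - H k y) * (real (k * d) * y ^ (k * d) / y)) / (y ^ (k * d) * y ^ (k * d))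
     = - (c k * U k y / y ^ (k * d + 1))"
    using y by (simp add: field_simps)
  finally show "((\<lambda>y. (U k y - H k y) / y ^ (k * d)) has_real_derivative
           - (c k * U k y / y ^ (k * d + 1))) (at y)" .
next
  have "((\<lambda>y. y ^ 0 * U k y - y ^ 0 * H k y) \<longlongrightarrow> 0 - 0) at_top"
    by (intro tendsto_diff conjunct1[OF tail_decay] conjunct2[OF tail_decay])
  hence "((\<lambda>y. U k y - H k y) \<longlongrightarrow> 0) at_top" by simp
  thus "((\<lambda>y. (U k y - H k y) / y ^ (k * d)) \<longlongrightarrow> 0) at_top"
  proof (rule Lim_null_comparison[rotated, OF tendsto_norm_zero])
    show "\<forall>\<^sub>F y in at_top. norm ((U k y - H k y) / y ^ (k * d)) \<le> norm (U k y - H k y)"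
      using eventually_ge_at_top[of 1]
    proof eventually_elim
      case (elim y)
      have "norm (U k y - H k y) \<le> norm (U k y - H k y) * y ^ (k * d)"
        using mult_left_mono[OF one_le_power[OF elim], of "norm (U k y - H k y)" "k * d"] by simp
      thus ?case using elim by (simp add: divide_le_eq abs_mult)
    qed
  qed
qed

text \<open>
  The quotient by \<open>y ^ (k * d)\<close> is strictly decreasing with limit \<open>0\<close>, whatever the sign of \<open>c k\<close>.
\<close>

lemma tail_J_pos:
  assumes "\<And>y. y > 0 \<Longrightarrow> U k y > 0" "\<And>i. i \<le> k \<Longrightarrow> c i \<noteq> 0" "y > 0"
  shows "(U k y - H k y) / c k > 0"
proof -
  have "0 < ((U k y - H k y) / y ^ (k * d)) / c k"
  proof (rule DERIV_neg_imp_decreasing_at_top[where f = "\<lambda>y. ((U k y - H k y) / y ^ (k * d)) / c k"])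
    show "((\<lambda>y. (U k y - H k y) / y ^ (k * d) / c k) \<longlongrightarrow> 0) at_top"
      using tendsto_divide[OF tail_quot(2)[of k] tendsto_const[of "c k"]] assms(2) by simp
    fix x assume "x \<ge> y"
    hence x: "x > 0" using assms(3) by simp
    have "((\<lambda>y. (U k y - H k y) / y ^ (k * d) / c k) has_real_derivative
           - (c k * U k x / x ^ (k * d + 1)) / c k) (at x)"
      by (intro DERIV_cdivide tail_quot(1) assms(2) x) auto
    moreover have "- (c k * U k x / x ^ (k * d + 1)) / c k < 0"
      using assms(1)[OF x] assms(2)[of k] x by (simp add: field_simps)
    ultimately show "\<exists>y. ((\<lambda>y. (U k y - H k y) / y ^ (k * d) / c k) has_real_derivative y) (at x) \<and> y < 0"
      by blast
  qed
  hence "0 < ((U k y - H k y) / c k) / y ^ (k * d)" by (simp only: divide_divide_eq_left mult.commute)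
  thus ?thesis using assms(3) by (subst (asm) zero_less_divide_iff) (auto simp: not_less)
qed

lemma tail_pos:
  assumes "\<And>i. i < k \<Longrightarrow> c i \<noteq> 0" "y > 0"
  shows "U k y > 0" and "H k y > 0"
proof -
  have U: "U k y > 0" if "y > 0" for y
    using assms(1) that
  proof (induction k arbitrary: y)
    case (Suc k)
    have "(U k y - H k y) / c k > 0"
      using Suc by (intro tail_J_pos) auto
    moreover have "real (Suc k * d) > 0" using d by (simp del: of_nat_mult)
    ultimately show ?case unfolding tailU.simps by (rule mult_pos_pos[rotated])
  qed simp
  show "U k y > 0" by (rule U) fact
  show "H k y > 0"
  proof (rule DERIV_neg_imp_decreasing_at_top[where f = "H k"])
    show "(H k \<longlongrightarrow> 0) at_top" using tail_decay[of 0 k] by simp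
    fix x assume "x \<ge> y"
    hence x: "x > 0" using assms by simp
    have "- (x ^ (d - 1) * U k x) < 0" using U[OF x] x by simp
    with tail_deriv(1)[OF x assms(1)]
    show "\<exists>z. (H k has_real_derivative z) (at x) \<and> z < 0" by blast
  qed
qed

text \<open>
  When \<open>c k = 0\<close> the quotient has derivative \<open>0\<close>, and a constant that tends to \<open>0\<close> is \<open>0\<close>. This is
  the exact value of the terminating fraction.
\<close>

lemma tail_terminates:
  assumes "\<And>i. i < k \<Longrightarrow> c i \<noteq> 0" "c k = 0" "y > 0"
  shows "U k y = H k y"
proof -
  let ?q = "\<lambda>y. (U k y - H k y) / y ^ (k * d)"
  have der: "(?q has_real_derivative 0) (at x)" if "x > 0" for x
    using tail_quot(1)[of k, OF assms(1) that] assms(2) by simp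
  have const: "?q x = ?q y" if "x > y" for x
  proof (rule DERIV_isconst2[where f = ?q and a = y and b = x and x = x])
    show "continuous_on {y..x} ?q"
      using der assms(3) by (intro continuous_at_imp_continuous_on ballI DERIV_isCont[OF der]) auto
  qed (use that der assms(3) in auto)
  have "(?q \<longlongrightarrow> ?q y) at_top"
    by (rule tendsto_eventually)
      (use eventually_gt_at_top[of y] in \<open>eventually_elim; use const in blast\<close>)
  with tail_quot(2)[of k, OF assms(1)] have "?q y = 0"
    by (metis tendsto_unique trivial_limit_at_top_linorder)
  thus ?thesis using assms(3) by simp
qed

end

section \<open>The primitive and its limits along the rays\<close>

lemma F_deriv: "(F n d has_field_derivative integrand n d z) (at z)"
  and F_0: "F n d 0 = 0"
proof -
  have "integrand n d holomorphic_on UNIV"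
    unfolding integrand_def by (cases "d = 0") (auto intro!: holomorphic_intros)
  then obtain g where g: "\<And>x. (g has_field_derivative integrand n d x) (at x)"
    using holomorphic_convex_primitive'[of UNIV "integrand n d"] by auto
  have "F n d = (\<lambda>z. g z - g 0)"
  proof
    fix z
    have "(integrand n d has_contour_integral (g (pathfinish (linepath 0 z)) - g (pathstart (linepath 0 z))))
        (linepath 0 z)"
      by (rule contour_integral_primitive[of UNIV]) (use g valid_path_linepath in blast)+
    thus "F n d z = g z - g 0" unfolding F_def by (simp add: contour_integral_unique)
  qed
  thus "(F n d has_field_derivative integrand n d z) (at z)" "F n d 0 = 0"
    using g by (auto intro!: derivative_eq_intros)
qed

text \<open>
  Rotation by a \<open>d\<close>-th root of unity reduces every sector to the one around the positive real axis.
\<close>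

lemma F_rotate:
  assumes "\<omega> ^ d = 1"
  shows "F n d (\<omega> * z) = \<omega> ^ (n + 1) * F n d z"
proof -
  have "((\<lambda>z. F n d (\<omega> * z) - \<omega> ^ (n + 1) * F n d z) has_field_derivative 0) (at z)" for z
  proof -
    have "((\<lambda>z. F n d (\<omega> * z)) has_field_derivative integrand n d (\<omega> * z) * \<omega>) (at z)"
      by (rule DERIV_chain2[OF F_deriv]) (auto intro!: derivative_eq_intros)
    moreover have "((\<lambda>z. \<omega> ^ (n + 1) * F n d z) has_field_derivative \<omega> ^ (n + 1) * integrand n d z) (at z)"
      by (rule DERIV_cmult[OF F_deriv])
    ultimately have "((\<lambda>z. F n d (\<omega> * z) - \<omega> ^ (n + 1) * F n d z) has_field_derivative
        (integrand n d (\<omega> * z) * \<omega> - \<omega> ^ (n + 1) * integrand n d z)) (at z)"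
      by (rule DERIV_diff)
    thus ?thesis by (simp add: integrand_def power_mult_distrib assms)
  qed
  hence "\<exists>c. \<forall>z\<in>UNIV. F n d (\<omega> * z) - \<omega> ^ (n + 1) * F n d z = c"
    by (intro has_field_derivative_zero_constant) auto
  hence "F n d (\<omega> * z) - \<omega> ^ (n + 1) * F n d z = F n d (\<omega> * 0) - \<omega> ^ (n + 1) * F n d 0"
    by (metis UNIV_I)
  thus ?thesis by (simp add: F_0)
qed

lemma F_of_real:
  obtains f :: "real \<Rightarrow> real" where "\<And>y. F n d (of_real y) = of_real (f y)"
    "\<And>y. (f has_real_derivative y ^ n * exp (- (y ^ d) / real d)) (at y)"
proof -
  define g where "g y = y ^ n * exp (- (y ^ d) / real d)" for y :: real
  have int: "integrand n d (of_real y) = of_real (g y)" for y :: real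
    by (simp add: integrand_def g_def exp_of_real[symmetric])
  have vec: "((\<lambda>y. F n d (of_real y)) has_vector_derivative of_real (g y)) (at y)" for y :: real
    using has_vector_derivative_real_field[OF F_deriv[of n d "of_real y"]] by (simp add: int o_def)
  have Re: "((\<lambda>y. Re (F n d (of_real y))) has_real_derivative g y) (at y)" for y :: real
    using has_field_derivative_Re[OF vec] by simp
  have Im: "((\<lambda>y. Im (F n d (of_real y))) has_real_derivative 0) (at y)" for y :: real
    using has_field_derivative_Im[OF vec] by simp
  have "Im (F n d (of_real y)) = 0" for y
    using DERIV_isconst_all[of "\<lambda>y. Im (F n d (of_real y))" y 0] Im by (simp add: F_0)
  hence "F n d (of_real y) = of_real (Re (F n d (of_real y)))" for y
    by (simp add: complex_eq_iff)
  thus ?thesis using Re unfolding g_def by (rule that)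
qed

text \<open>
  From some point on the derivative is at most \<open>exp (- (y / C))\<close>, so \<open>f\<close> increases while
  \<open>f + C * exp (- (y / C))\<close> decreases. This traps the limit and gives the rate of convergence, from
  which the decay against all powers follows.
\<close>

lemma ray_limit_exists:
  fixes f :: "real \<Rightarrow> real"
  assumes d: "d \<ge> 1"
    and f: "\<And>y. (f has_real_derivative y ^ n * exp (- (y ^ d) / real d)) (at y)"
  obtains L C where "C > 0" "\<forall>\<^sub>F y in at_top. \<bar>L - f y\<bar> \<le> C * exp (- (y / C))"
proof -
  define C where "C = 2 * real d"
  have C: "C > 0" using d by (simp add: C_def)
  have "((\<lambda>y::real. y ^ n * exp (- (1 / C * y))) \<longlongrightarrow> 0) at_top"
    using C by (intro power_exp_tendsto_0) simp
  hence "\<forall>\<^sub>F y::real in at_top. y ^ n * exp (- (1 / C * y)) < 1"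
    by (rule order_tendstoD(2)) simp
  then obtain Y0 :: real where Y0: "\<And>y. y \<ge> Y0 \<Longrightarrow> y ^ n * exp (- (y / C)) < 1"
    by (auto simp: eventually_at_top_linorder)
  define Y where "Y = max Y0 1"
  have g: "y ^ n * exp (- (y ^ d) / real d) \<le> exp (- (y / C))" if "y \<ge> Y" for y
  proof -
    have y: "y \<ge> 1" "y ^ n * exp (- (y / C)) < 1" using that Y0[of y] by (auto simp: Y_def)
    have "y \<le> y ^ d" using power_increasing[of 1 d y] d y by simp
    \<comment> \<open>One of the two factors \<open>exp (- (y / C))\<close> absorbs the power \<open>y ^ n\<close>.\<close>
    hence "- (y ^ d) / real d \<le> - (y / C) + - (y / C)"
      using d by (simp add: C_def field_simps)
    hence "exp (- (y ^ d) / real d) \<le> exp (- (y / C) + - (y / C))"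
      by (simp only: exp_le_cancel_iff)
    hence "y ^ n * exp (- (y ^ d) / real d) \<le> y ^ n * exp (- (y / C) + - (y / C))"
      using y by (intro mult_left_mono) auto
    hence "y ^ n * exp (- (y ^ d) / real d) \<le> (y ^ n * exp (- (y / C))) * exp (- (y / C))"
      by (simp only: exp_add mult.assoc)
    also have "\<dots> \<le> 1 * exp (- (y / C))" using y by (intro mult_right_mono) auto
    finally show ?thesis by simp
  qed
  have incr: "f x \<le> f y" if "Y \<le> x" "x \<le> y" for x y
    by (rule DERIV_nonneg_imp_nondecreasing[OF that(2)])
      (use f that in \<open>auto intro!: exI mult_nonneg_nonneg simp: Y_def\<close>)
  have decr: "f y + C * exp (- (y / C)) \<le> f x + C * exp (- (x / C))" if "Y \<le> x" "x \<le> y" for x y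
  proof (rule DERIV_nonpos_imp_nonincreasing[OF that(2)])
    fix t assume t: "x \<le> t" "t \<le> y"
    have "((\<lambda>y. f y + C * exp (- (y / C))) has_real_derivative
        t ^ n * exp (- (t ^ d) / real d) - exp (- (t / C))) (at t)"
      using C by (auto intro!: derivative_eq_intros f)
    moreover have "t ^ n * exp (- (t ^ d) / real d) - exp (- (t / C)) \<le> 0"
      using g[of t] t that by simp
    ultimately show "\<exists>z. ((\<lambda>y. f y + C * exp (- (y / C))) has_real_derivative z) (at t) \<and> z \<le> 0"
      by blast
  qed
  define X where "X m = f (Y + real m)" for m
  have "incseq X" unfolding X_def by (intro monoI incr) auto
  moreover have "X m \<le> f Y + C * exp (- (Y / C))" for m
  proof -
    have "C * exp (- ((Y + real m) / C)) \<ge> 0" using C by simp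
    thus ?thesis using decr[of Y "Y + real m"] by (simp add: X_def)
  qed
  ultimately obtain L where L: "X \<longlonglongrightarrow> L" "\<And>m. X m \<le> L"
    using incseq_convergent[of X] by blast
  have "\<bar>L - f y\<bar> \<le> C * exp (- (y / C))" if y: "y \<ge> Y" for y
  proof -
    obtain m where m: "y \<le> Y + real m"
      by (metis add.commute diff_le_eq real_arch_simple)
    have "f y \<le> L" using incr[OF y m] L(2)[of m] by (simp add: X_def)
    moreover have "L \<le> f y + C * exp (- (y / C))"
    proof (rule LIMSEQ_le_const2[OF L(1)], intro exI allI impI)
      fix k assume "k \<ge> m"
      hence "y \<le> Y + real k" using m by simp
      moreover have "C * exp (- ((Y + real k) / C)) \<ge> 0" using C by simp
      ultimately show "X k \<le> f y + C * exp (- (y / C))"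
        using decr[OF y, of "Y + real k"] by (simp add: X_def)
    qed
    ultimately show ?thesis by simp
  qed
  hence "\<forall>\<^sub>F y in at_top. \<bar>L - f y\<bar> \<le> C * exp (- (y / C))"
    by (auto simp: eventually_at_top_linorder)
  with C show ?thesis by (rule that)
qed

lemma omega_power: "d \<ge> 1 \<Longrightarrow> omega d j ^ d = 1"
  unfolding omega_def exp_of_nat_mult[symmetric]
  using exp_integer_2pi[of "of_nat j"] by (simp add: mult_ac)

lemma W_eq:
  assumes "d \<ge> 1" "((\<lambda>y. F n d (of_real y)) \<longlongrightarrow> l) at_top"
  shows "W n d j = omega d j ^ (n + 1) * l"
  unfolding W_def
proof (rule tendsto_Lim)
  have "contour_integral (linepath 0 (of_real R * omega d j)) (integrand n d)
      = omega d j ^ (n + 1) * F n d (of_real R)" for R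
    using F_rotate[OF omega_power[OF assms(1)], of n j "of_real R"]
    by (simp add: F_def mult.commute)
  thus "((\<lambda>R. contour_integral (linepath 0 (of_real R * omega d j)) (integrand n d))
      \<longlongrightarrow> omega d j ^ (n + 1) * l) at_top"
    using tendsto_mult_left[OF assms(2)] by simp
qed simp

section \<open>Remainders of the continued fraction\<close>

lemma pnum_even: "pnum n d (2 * k + 2) = of_real (hcoef n d k)"
  by (simp add: pnum_def hcoef_def)

lemma pnum_odd: "k \<ge> 1 \<Longrightarrow> pnum n d (2 * k + 1) = of_real (real (k * d))"
  by (simp add: pnum_def)

text \<open>
  The remainder \<open>cf_A m - v * cf_B m\<close> at real \<open>w = u\<close>, in closed form and scaled by the
  positive factor \<open>tailU 0\<close> to avoid denominators.
\<close>

definition ray_err :: "nat \<Rightarrow> nat \<Rightarrow> (real \<Rightarrow> real) \<Rightarrow> real \<Rightarrow> real \<Rightarrow> nat \<Rightarrow> real" where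
  "ray_err n d G y u m =
     (\<Prod>i<m div 2. hcoef n d i) *
       (if even m then - (tailH n d G (m div 2) y / u)
        else tailU n d G (m div 2) y - tailH n d G (m div 2) y)"

text \<open>
  The recurrence for \<open>tailH\<close> and \<open>tailU\<close> is the recurrence of the fraction, split by parity. The
  hypothesis only concerns the coefficients that have been divided by, which leaves room for the
  first index with \<open>hcoef n d k = 0\<close>.
\<close>

lemma ray_err_eq:
  fixes n d :: nat and u y :: real and G :: "real \<Rightarrow> real"
  assumes u: "u > 0" and y: "y > 0" "y ^ d = u\<^sup>2"
  defines "v \<equiv> complex_of_real (G y / (u * tailU n d G 0 y))"
  assumes nz: "\<And>i. i < m div 2 \<Longrightarrow> hcoef n d i \<noteq> 0"
  shows "of_real (tailU n d G 0 y) * (cf_A (pnum n d) (\<lambda>_. of_real u) m - v * cf_B (pnum n d) (\<lambda>_. of_real u) m)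
       = of_real (ray_err n d G y u m)"
  using nz
proof (induction m rule: induct_nat_012)
  case 0
  have "tailU n d G 0 y > 0" using u y by simp
  thus ?case by (simp add: v_def ray_err_def del: tailU.simps)
next
  case 1
  have "tailU n d G 0 y > 0" using u y by simp
  thus ?case using u by (simp add: v_def ray_err_def pnum_def algebra_simps del: tailU.simps)
next
  case (ge2 m)
  let ?A = "cf_A (pnum n d) (\<lambda>_. of_real u)" and ?B = "cf_B (pnum n d) (\<lambda>_. of_real u)"
  let ?U0 = "complex_of_real (tailU n d G 0 y)" and ?a = "pnum n d (Suc (Suc m))"
  have IH: "?U0 * (?A m - v * ?B m) = of_real (ray_err n d G y u m)"
    "?U0 * (?A (Suc m) - v * ?B (Suc m)) = of_real (ray_err n d G y u (Suc m))"
    using ge2 by auto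
  have "?U0 * (?A (Suc (Suc m)) - v * ?B (Suc (Suc m)))
     = of_real u * (?U0 * (?A (Suc m) - v * ?B (Suc m))) + ?a * (?U0 * (?A m - v * ?B m))"
    by (simp add: algebra_simps del: tailU.simps)
  also have "\<dots> = of_real u * of_real (ray_err n d G y u (Suc m)) + ?a * of_real (ray_err n d G y u m)"
    by (simp only: IH)
  also have "\<dots> = of_real (ray_err n d G y u (Suc (Suc m)))"
  proof (cases "even m")
    case True
    then obtain k where m: "m = 2 * k" by blast
    have a: "?a = of_real (hcoef n d k)" using pnum_even[of n d k] by (simp add: m)
    have ck: "hcoef n d k \<noteq> 0" using ge2.prems[of k] by (simp add: m)
    have "u * ray_err n d G y u (Suc m) + hcoef n d k * ray_err n d G y u m
       = ray_err n d G y u (Suc (Suc m))"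
      using u ck by (simp add: ray_err_def m y(2) field_simps power2_eq_square)
    thus ?thesis unfolding a by (simp flip: of_real_mult of_real_add)
  next
    case False
    then obtain k where m: "m = 2 * k + 1" by (elim oddE) 
    have a: "?a = of_real (real (Suc k * d))" using pnum_odd[of "Suc k" n d] by (simp add: m)
    have ck: "hcoef n d k \<noteq> 0" using ge2.prems[of k] by (simp add: m)
    have "u * ray_err n d G y u (Suc m) + real (Suc k * d) * ray_err n d G y u m
       = ray_err n d G y u (Suc (Suc m))"
      using u ck by (simp add: ray_err_def m y(2) field_simps)
    thus ?thesis unfolding a by (simp only: of_real_mult[symmetric] of_real_add[symmetric])
  qed
  finally show ?case .
qed

lemma hcoef_pos:
  assumes "d \<ge> 1" "k > n"
  shows "hcoef n d k > 0"
proof -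
  have "Suc k * 1 \<le> Suc k * d" using assms(1) by (intro mult_left_mono) auto
  hence "real (Suc k) \<le> real (Suc k * d)" by (simp only: of_nat_le_iff mult_1_right)
  thus ?thesis using assms(2) unfolding hcoef_def by linarith
qed

text \<open>
  \<open>tailH\<close> and the quotient of \<open>tailU - tailH\<close> by \<open>hcoef\<close> are positive, and the closed form carries
  a minus sign at even indices only. Once \<open>hcoef > 0\<close> the product in front keeps its sign.
\<close>

lemma ray_err_alternates:
  fixes n d :: nat and G :: "real \<Rightarrow> real"
  assumes d: "d \<ge> 1"
    and G: "\<And>y. y > 0 \<Longrightarrow> (G has_real_derivative - (y ^ n * exp (- (y ^ d) / real d))) (at y)"
      "\<And>p. ((\<lambda>y. y ^ p * G y) \<longlongrightarrow> 0) at_top"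
    and nz: "\<And>i. hcoef n d i \<noteq> 0" and pos: "hcoef n d (m div 2) > 0"
    and uy: "u > 0" "y > 0"
  shows "ray_err n d G y u m * ray_err n d G y u (Suc m) < 0"
proof -
  define k where "k = m div 2"
  define P where "P = (\<Prod>i<k. hcoef n d i)"
  have P: "P \<noteq> 0" using nz by (simp add: P_def)
  have c: "hcoef n d k > 0" using pos by (simp add: k_def)
  note tp = tail_pos[OF d G nz uy(2)]
  have J: "(tailU n d G k y - tailH n d G k y) / hcoef n d k > 0"
    by (rule tail_J_pos[OF d G _ nz uy(2)]) (use tail_pos(1)[OF d G nz] in auto)
  hence D: "tailU n d G k y - tailH n d G k y > 0" using c by (simp add: zero_less_divide_iff)
  show ?thesis
  proof (cases "even m")
    case True
    hence m: "m div 2 = k" "Suc m div 2 = k" by (auto simp: k_def)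
    have "ray_err n d G y u m * ray_err n d G y u (Suc m)
        = - (P\<^sup>2 * (tailH n d G k y / u * (tailU n d G k y - tailH n d G k y)))"
      using True by (simp add: ray_err_def m P_def power2_eq_square)
    moreover have "P\<^sup>2 * (tailH n d G k y / u * (tailU n d G k y - tailH n d G k y)) > 0"
      using P D tp(2)[of k] uy by (intro mult_pos_pos) auto
    ultimately show ?thesis by linarith
  next
    case False
    hence m: "m div 2 = k" "Suc m div 2 = Suc k" by (auto simp: k_def)
    have "ray_err n d G y u m * ray_err n d G y u (Suc m)
        = - (P\<^sup>2 * (hcoef n d k * (tailH n d G (Suc k) y / u * (tailU n d G k y - tailH n d G k y))))"
      using False by (simp add: ray_err_def m P_def power2_eq_square del: tailH.simps)
    moreover have "P\<^sup>2 * (hcoef n d k * (tailH n d G (Suc k) y / u * (tailU n d G k y - tailH n d G k y))) > 0"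
      using P D c tp(2)[of "Suc k"] uy by (intro mult_pos_pos) (auto simp del: tailH.simps)
    ultimately show ?thesis by linarith
  qed
qed

section \<open>From the real ray to the half-plane\<close>

lemma cf_holomorphic:
  "(\<lambda>w. cf_A a (\<lambda>_. w) m) holomorphic_on S" "(\<lambda>w. cf_B a (\<lambda>_. w) m) holomorphic_on S"
proof (induction m rule: induct_nat_012)
  case (ge2 m)
  { case 1 show ?case using ge2 by (auto intro!: holomorphic_intros)
  next case 2 show ?case using ge2 by (auto intro!: holomorphic_intros) }
qed auto

lemma half_plane:
  defines "S \<equiv> {w::complex. Re w > 0}" and "R \<equiv> complex_of_real ` {0<..}"
  shows "open S" "connected S" "R \<subseteq> S" "1 \<in> S" "1 islimpt R"
proof -
  show "open S" unfolding S_def by (rule open_halfspace_Re_gt)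
  show "connected S" unfolding S_def by (intro convex_connected convex_halfspace_Re_gt)
  show "R \<subseteq> S" "1 \<in> S" by (auto simp: S_def R_def)
  show "1 islimpt R"
    unfolding islimpt_approachable
  proof (intro allI impI)
    fix e :: real assume "e > 0"
    thus "\<exists>x'\<in>R. x' \<noteq> 1 \<and> dist x' 1 < e"
      unfolding R_def by (intro bexI[OF _ imageI[of "1 + e / 2"]]) (auto simp: dist_norm)
  qed
qed

text \<open>
  Let \<open>f m\<close> be the remainder \<open>cf_A m - v * cf_B m\<close>. Only the partial numerators beyond \<open>Suc p\<close> are
  assumed positive, so the value region argument is available for the tail fraction alone. Its
  denominators \<open>B'\<close> have no zeros, and \<open>E i = f (Suc p + i) / B' i\<close> tends to \<open>0\<close> on the real ray,
  hence on the half-plane. The splice formula expresses \<open>cf_B (Suc p + i) / B' i\<close> through \<open>E i\<close>; its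
  limit is a Casoratian, that is, up to sign a product of partial numerators, divided by \<open>f p\<close>.
  It is therefore not \<open>0\<close>, and \<open>f m / cf_B m\<close> tends to \<open>0\<close>. The full denominators may vanish at
  finitely many indices, because early partial numerators may be negative.
\<close>

lemma pincherle_half_plane:
  fixes a :: "nat \<Rightarrow> complex" and v :: "complex \<Rightarrow> complex" and p :: nat
  defines "S \<equiv> {w::complex. Re w > 0}"
  defines "f \<equiv> \<lambda>m w. cf_A a (\<lambda>_. w) m - v w * cf_B a (\<lambda>_. w) m"
  assumes hol: "v holomorphic_on S"
    and nz: "\<And>i. i \<ge> 1 \<Longrightarrow> a i \<noteq> 0"
    and \<alpha>: "\<And>i. i \<ge> 1 \<Longrightarrow> a (Suc p + i) = of_real (\<alpha> i)" "\<And>i. i \<ge> 1 \<Longrightarrow> \<alpha> i > 0"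
    and C: "C > 0" "\<And>i. \<alpha> (i + 2) \<le> C * (real i + 1)"
    and ray: "\<And>u. u > 0 \<Longrightarrow> \<exists>q e. q \<noteq> 0 \<and> (\<forall>i. q * f (Suc p + i) (of_real u) = of_real (e i) \<and> e i * e (Suc i) < (0::real))"
    and w: "w \<in> S"
  shows "\<forall>\<^sub>F m in sequentially. cf_B a (\<lambda>_. w) m \<noteq> 0"
    and "(\<lambda>m. cf_A a (\<lambda>_. w) m / cf_B a (\<lambda>_. w) m) \<longlonglongrightarrow> v w"
proof -
  define A' where "A' i z = cf_A (\<lambda>i. complex_of_real (\<alpha> i)) (\<lambda>_. z) i" for i z
  define B' where "B' i z = cf_B (\<lambda>i. complex_of_real (\<alpha> i)) (\<lambda>_. z) i" for i z
  define a' where "a' = (\<lambda>i. a (Suc p + i))"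
  have a'_eq: "a' i = of_real (\<alpha> i)" if "i \<ge> 1" for i
    unfolding a'_def by (rule \<alpha>(1)[OF that])
  have tail_eq: "cf_A a' b i = cf_A (\<lambda>i. complex_of_real (\<alpha> i)) b i \<and> cf_B a' b i = cf_B (\<lambda>i. complex_of_real (\<alpha> i)) b i" for b i
    by (induction i rule: induct_nat_012) (simp_all add: a'_eq)
  have spliceA: "cf_A a (\<lambda>_. z) (Suc p + i) = cf_A a (\<lambda>_. z) (Suc p) * B' i z + cf_A a (\<lambda>_. z) p * A' i z"
    and spliceB: "cf_B a (\<lambda>_. z) (Suc p + i) = cf_B a (\<lambda>_. z) (Suc p) * B' i z + cf_B a (\<lambda>_. z) p * A' i z" for i z
    using cf_splice[of a "\<lambda>_. z" p i] tail_eq[of "\<lambda>_. z" i] unfolding a'_def A'_def B'_def by auto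
  have splice: "f (Suc p + i) z = f (Suc p) z * B' i z + f p z * A' i z" for i z
    unfolding f_def spliceA[of z i] spliceB[of z i] by (simp add: algebra_simps)
  have hp: "B' i z \<noteq> 0" "norm (A' i z / B' i z) \<le> \<alpha> 1 / Re z" if "z \<in> S" for i z
    using cf_half_plane[of z \<alpha> i] that \<alpha>(2) by (auto simp: S_def A'_def B'_def)
  have f_hol: "f m holomorphic_on S" for m
    unfolding f_def by (intro holomorphic_intros cf_holomorphic hol)
  define E where "E i z = f (Suc p + i) z / B' i z" for i z
  have E_eq: "E i z = f (Suc p) z + f p z * (A' i z / B' i z)" if "z \<in> S" for i z
    using hp(1)[OF that] unfolding E_def splice by (simp add: field_simps)
  have E_lim: "(\<lambda>i. E i w) \<longlonglongrightarrow> 0"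
  proof (rule vitali_tendsto_0[where S = S and \<xi> = 1 and U = "complex_of_real ` {0<..}"])
    show "E i holomorphic_on S" for i
      unfolding E_def using f_hol hp(1)
      by (intro holomorphic_on_divide) (auto simp: B'_def intro: cf_holomorphic)
    show "continuous_on S (\<lambda>z. norm (f (Suc p) z) + norm (f p z) * (\<alpha> 1 / Re z))"
      using f_hol by (intro continuous_intros holomorphic_on_imp_continuous_on) (auto simp: S_def)
    show "norm (E i z) \<le> norm (f (Suc p) z) + norm (f p z) * (\<alpha> 1 / Re z)" if "z \<in> S" for i z
    proof -
      have "norm (E i z) \<le> norm (f (Suc p) z) + norm (f p z * (A' i z / B' i z))"
        unfolding E_eq[OF that] by (rule norm_triangle_ineq)
      also have "norm (f p z * (A' i z / B' i z)) \<le> norm (f p z) * (\<alpha> 1 / Re z)"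
        unfolding norm_mult by (intro mult_left_mono hp that) auto
      finally show ?thesis by simp
    qed
    fix z assume "z \<in> complex_of_real ` {0<..}"
    then obtain u where u: "u > 0" "z = of_real u" by auto
    obtain q e where q: "q \<noteq> 0" and e: "\<And>i. q * f (Suc p + i) z = of_real (e i)"
      "\<And>i. e i * e (Suc i) < (0::real)"
      using ray[OF u(1)] u(2) by auto
    have "\<exists>\<beta>. \<forall>i. \<beta> i > 0 \<and> B' i z = complex_of_real (\<beta> i)"
      unfolding B'_def u(2) using cf_B_real_pos[of u \<alpha>] u(1) \<alpha>(2) by (intro choice) auto
    then obtain \<beta> where \<beta>: "\<And>i. \<beta> i > 0" "\<And>i. B' i z = complex_of_real (\<beta> i)" by blast
    have "(\<lambda>i. e i / \<beta> i) \<longlonglongrightarrow> 0"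
    proof (rule alternating_solution_over_positive_tendsto_0[OF u(1) C(1) _ C(2)])
      show "\<alpha> (i + 2) > 0" for i using \<alpha>(2) by simp
      show "e (i + 2) = u * e (i + 1) + \<alpha> (i + 2) * e i" for i
      proof -
        have "of_real (e (i + 2)) = z * of_real (e (i + 1)) + of_real (\<alpha> (i + 2)) * complex_of_real (e i)"
          unfolding e(1)[symmetric] using \<alpha>(1)[of "i + 2"] by (simp add: f_def algebra_simps)
        thus ?thesis unfolding u(2) of_real_mult[symmetric] of_real_add[symmetric] of_real_eq_iff .
      qed
      show "e i * e (Suc i) < 0" for i by (rule e(2))
      show "\<beta> (i + 2) = u * \<beta> (i + 1) + \<alpha> (i + 2) * \<beta> i" for i
      proof -
        have "of_real (\<beta> (i + 2)) = z * of_real (\<beta> (i + 1)) + of_real (\<alpha> (i + 2)) * complex_of_real (\<beta> i)"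
          unfolding \<beta>(2)[symmetric] by (simp add: B'_def)
        thus ?thesis unfolding u(2) of_real_mult[symmetric] of_real_add[symmetric] of_real_eq_iff .
      qed
      show "\<beta> i > 0" for i by (rule \<beta>(1))
      have "of_real (\<beta> 1) = complex_of_real (u * \<beta> 0)"
        unfolding of_real_mult \<beta>(2)[symmetric] by (simp add: B'_def u(2))
      thus "\<beta> 1 \<ge> u * \<beta> 0" unfolding of_real_eq_iff by simp
    qed
    hence "(\<lambda>i. of_real (e i / \<beta> i) / q) \<longlonglongrightarrow> of_real 0 / q"
      by (intro tendsto_divide tendsto_of_real tendsto_const q)
    also have "(\<lambda>i. of_real (e i / \<beta> i) / q) = (\<lambda>i. E i z)"
      unfolding E_def of_real_divide e(1)[symmetric] \<beta>(2) using q by auto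
    finally show "(\<lambda>i. E i z) \<longlonglongrightarrow> 0" by simp
  qed (use half_plane w in \<open>auto simp: S_def\<close>)
  let ?A = "cf_A a (\<lambda>_. w)" and ?B = "cf_B a (\<lambda>_. w)"
  have cas: "f (Suc p) w * ?B p - f p w * ?B (Suc p) \<noteq> 0"
  proof -
    have "f (Suc p) w * ?B p - f p w * ?B (Suc p) = ?A (Suc p) * ?B p - ?A p * ?B (Suc p)"
      by (simp add: f_def algebra_simps)
    thus ?thesis unfolding cf_casoratian using nz by simp
  qed
  \<comment> \<open>If \<open>f p w\<close> vanished, \<open>E i w\<close> would be the constant \<open>f (Suc p) w\<close>, so two neighbouring remainders would be \<open>0\<close>.\<close>
  have fp: "f p w \<noteq> 0"
  proof
    assume 0: "f p w = 0"
    hence "(\<lambda>i. f (Suc p) w) \<longlonglongrightarrow> 0" using E_lim w by (simp add: E_eq)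
    hence "f (Suc p) w = 0" by (simp add: LIMSEQ_const_iff)
    with 0 cas show False by simp
  qed
  define D where "D i = ?B (Suc p + i) / B' i w" for i
  have "(\<lambda>i. ?B (Suc p) + ?B p * ((E i w - f (Suc p) w) / f p w)) \<longlonglongrightarrow>
      ?B (Suc p) + ?B p * ((0 - f (Suc p) w) / f p w)"
    by (intro tendsto_intros E_lim fp)
  also have "(\<lambda>i. ?B (Suc p) + ?B p * ((E i w - f (Suc p) w) / f p w)) = D"
  proof
    fix i
    have "(E i w - f (Suc p) w) / f p w = A' i w / B' i w" using fp by (simp add: E_eq[OF w])
    thus "?B (Suc p) + ?B p * ((E i w - f (Suc p) w) / f p w) = D i"
      unfolding D_def spliceB using hp(1)[OF w, of i] by (simp add: add_divide_distrib)
  qed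
  finally have D_lim: "D \<longlonglongrightarrow> ?B (Suc p) - ?B p * f (Suc p) w / f p w" by simp
  have D_nz: "?B (Suc p) - ?B p * f (Suc p) w / f p w \<noteq> 0"
    using cas fp by (simp add: field_simps)
  have ev: "\<forall>\<^sub>F i in sequentially. ?B (i + Suc p) \<noteq> 0"
    using tendsto_imp_eventually_ne[OF D_lim D_nz]
    by eventually_elim (auto simp: D_def add.commute)
  thus B_nz: "\<forall>\<^sub>F m in sequentially. ?B m \<noteq> 0"
    using eventually_sequentially_seg[of "\<lambda>m. ?B m \<noteq> 0" "Suc p"] by blast
  have "(\<lambda>i. v w + E i w / D i) \<longlonglongrightarrow> v w + 0 / (?B (Suc p) - ?B p * f (Suc p) w / f p w)"
    by (intro tendsto_intros E_lim D_lim D_nz)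
  hence "(\<lambda>i. v w + E i w / D i) \<longlonglongrightarrow> v w" by simp
  moreover have "\<forall>\<^sub>F i in sequentially. v w + E i w / D i = ?A (i + Suc p) / ?B (i + Suc p)"
    using ev
  proof eventually_elim
    case (elim i)
    have "E i w / D i = f (i + Suc p) w / ?B (i + Suc p)"
      using hp(1)[OF w, of i] by (simp add: E_def D_def add.commute)
    thus ?case using elim by (simp add: f_def diff_divide_distrib)
  qed
  ultimately have "(\<lambda>i. ?A (i + Suc p) / ?B (i + Suc p)) \<longlonglongrightarrow> v w"
    by (rule Lim_transform_eventually)
  thus "(\<lambda>m. ?A m / ?B m) \<longlonglongrightarrow> v w" by (rule LIMSEQ_offset)
qed

section \<open>The value of the fraction\<close>

text \<open>
  Here \<open>w\<close> is the square root of \<open>y ^ d\<close> in the right half-plane and \<open>exp (2 / d * Ln w)\<close> recovers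
  \<open>y\<close>; \<open>l\<close> stands for the limit of \<open>F n d\<close> along the positive real axis. The factor \<open>w\<close> belongs to
  the normalisation with constant partial denominator \<open>w\<close>.
\<close>

definition cf_limit :: "nat \<Rightarrow> nat \<Rightarrow> complex \<Rightarrow> complex \<Rightarrow> complex" where
  "cf_limit n d l w = w * (l - F n d (exp (2 / of_nat d * Ln w)))
     / exp (2 / of_nat d * Ln w) ^ (n + 1) * exp (w\<^sup>2 / of_nat d)"

lemma cf_limit_holomorphic:
  "cf_limit n d l holomorphic_on {w. Re w > 0}"
proof -
  have F: "F n d holomorphic_on UNIV"
    using F_deriv by (auto simp: holomorphic_on_def field_differentiable_def intro: has_field_derivative_at_within)
  have Y: "(\<lambda>w. exp (2 / of_nat d * Ln w)) holomorphic_on {w. Re w > 0}"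
    by (intro holomorphic_intros) (auto simp: complex_nonpos_Reals_iff)
  have "(\<lambda>w. F n d (exp (2 / of_nat d * Ln w))) holomorphic_on {w. Re w > 0}"
    using holomorphic_on_compose_gen[OF Y F] by (simp add: o_def)
  thus ?thesis unfolding cf_limit_def
    by (cases "d = 0") (auto intro!: holomorphic_intros Y simp: complex_nonpos_Reals_iff)
qed

text \<open>
  In the terminating case the remainder at the last index vanishes on the real ray, hence on the
  half-plane, and the Casoratian excludes that the last denominator vanishes as well. In the
  other case all remainders from index \<open>2 * n + 2\<close> on alternate on the ray.
\<close>

lemma cf_symmetric:
  assumes d: "d \<ge> 1"
  obtains l where "((\<lambda>y. F n d (of_real y)) \<longlongrightarrow> l) at_top"
    "\<And>w. Re w > 0 \<Longrightarrow> cf_has_value (pnum n d) (\<lambda>_. w) (cf_limit n d l w)"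
proof -
  obtain f where f: "\<And>y. F n d (of_real y) = of_real (f y)"
    "\<And>y. (f has_real_derivative y ^ n * exp (- (y ^ d) / real d)) (at y)"
    by (rule F_of_real) blast
  obtain L C where C: "C > 0" and L: "\<forall>\<^sub>F y in at_top. \<bar>L - f y\<bar> \<le> C * exp (- (y / C))"
    by (rule ray_limit_exists[OF d f(2)]) blast
  define G where "G y = L - f y" for y
  have G_deriv: "(G has_real_derivative - (y ^ n * exp (- (y ^ d) / real d))) (at y)" for y
    unfolding G_def by (auto intro!: derivative_eq_intros f(2))
  have G_decay: "((\<lambda>y. y ^ p * G y) \<longlongrightarrow> 0) at_top" for p
  proof (rule Lim_null_comparison)
    show "((\<lambda>y. C * (y ^ p * exp (- (1 / C * y)))) \<longlongrightarrow> 0) at_top"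
      using C by (intro tendsto_mult_right_zero power_exp_tendsto_0) simp
    show "\<forall>\<^sub>F y in at_top. norm (y ^ p * G y) \<le> C * (y ^ p * exp (- (1 / C * y)))"
      using L eventually_ge_at_top[of 0]
    proof eventually_elim
      case (elim y)
      have "y ^ p * \<bar>L - f y\<bar> \<le> y ^ p * (C * exp (- (y / C)))"
        using elim by (intro mult_left_mono) auto
      thus ?case using elim by (simp add: G_def abs_mult mult_ac)
    qed
  qed
  let ?l = "complex_of_real L" and ?S = "{w::complex. Re w > 0}"
  let ?v = "cf_limit n d ?l" and ?a = "pnum n d"
  have "(G \<longlongrightarrow> 0) at_top" using G_decay[of 0] by simp
  hence "((\<lambda>y. L - G y) \<longlongrightarrow> L - 0) at_top" by (intro tendsto_intros)
  hence lim: "((\<lambda>y. F n d (of_real y)) \<longlongrightarrow> ?l) at_top"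
    unfolding f(1) by (intro tendsto_of_real) (simp add: G_def)
  define err where "err m w = cf_A ?a (\<lambda>_. w) m - ?v w * cf_B ?a (\<lambda>_. w) m" for m w
  have err_hol: "err m holomorphic_on ?S" for m
    unfolding err_def by (intro holomorphic_intros cf_holomorphic cf_limit_holomorphic)
  have ray: "\<exists>q y. q \<noteq> 0 \<and> y > 0 \<and> (\<forall>m. (\<forall>i<m div 2. hcoef n d i \<noteq> 0) \<longrightarrow>
      q * err m (of_real u) = of_real (ray_err n d G y u m))" if u: "u > 0" for u
  proof -
    define y where "y = exp (2 / real d * ln u)"
    have y: "y > 0" by (simp add: y_def)
    have "y ^ d = exp (2 * ln u)"
      unfolding y_def exp_of_nat_mult[symmetric] using d by simp
    also have "\<dots> = u\<^sup>2" using u exp_of_nat_mult[of 2 "ln u"] by simp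
    finally have yd: "y ^ d = u\<^sup>2" .
    have "exp (2 / of_nat d * Ln (of_real u)) = exp (of_real (2 / real d * ln u))"
      using u by (simp add: Ln_of_real)
    also have "\<dots> = complex_of_real y" unfolding exp_of_real y_def ..
    finally have Y: "exp (2 / of_nat d * Ln (of_real u)) = complex_of_real y" .
    have "?v (of_real u) = of_real (u * G y / y ^ (n + 1) * exp (u\<^sup>2 / real d))"
      unfolding cf_limit_def Y f(1) by (simp add: G_def exp_of_real[symmetric])
    also have "u * G y / y ^ (n + 1) * exp (u\<^sup>2 / real d) = G y / (u * tailU n d G 0 y)"
      using u y by (simp add: yd exp_minus field_simps power2_eq_square)
    finally have v: "?v (of_real u) = of_real (G y / (u * tailU n d G 0 y))" .
    have "complex_of_real (tailU n d G 0 y) \<noteq> 0" using y by simp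
    thus ?thesis
      using y ray_err_eq[OF u y yd, of _ n G] unfolding err_def v by blast
  qed
  have "cf_has_value ?a (\<lambda>_. w) (?v w)" if w: "Re w > 0" for w
  proof (cases "cf_terminates ?a")
    case True
    define M where "M = (LEAST M. ?a (Suc M) = 0)"
    have M0: "?a (Suc M) = 0"
      using True unfolding cf_terminates_def M_def by (rule LeastI_ex)
    have M_least: "?a i \<noteq> 0" if "1 \<le> i" "i \<le> M" for i
      using not_less_Least[of "i - 1" "\<lambda>M. ?a (Suc M) = 0"] that unfolding M_def by auto
    have odd: "odd M"
    proof
      assume "even M"
      then obtain k where k: "M = 2 * k" by blast
      show False
      proof (cases "k = 0")
        case True thus False using M0 by (simp add: k pnum_def)
      next
        case False
        thus False using M0 pnum_odd[of k n d] d by (simp add: k)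
      qed
    qed
    then obtain k where k: "M = 2 * k + 1" by (elim oddE)
    have ck: "hcoef n d k = 0" using M0 pnum_even[of n d k] by (simp add: k)
    have ci: "hcoef n d i \<noteq> 0" if "i < k" for i
      using M_least[of "2 * i + 2"] that pnum_even[of n d i] by (simp add: k)
    have "err M w = 0"
    proof (rule analytic_continuation[OF err_hol half_plane])
      fix z assume "z \<in> complex_of_real ` {0<..}"
      then obtain u where u: "u > 0" "z = of_real u" by auto
      obtain q y where q: "q \<noteq> 0" "y > 0" "q * err M z = of_real (ray_err n d G y u M)"
        using ray[OF u(1)] ci unfolding u(2) k by auto
      have "ray_err n d G y u M = 0"
        using tail_terminates[OF d G_deriv G_decay ci ck q(2)] by (simp add: ray_err_def k)
      thus "err M z = 0" using q by simp
    qed (use w in simp)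
    hence A: "cf_A ?a (\<lambda>_. w) M = ?v w * cf_B ?a (\<lambda>_. w) M" by (simp add: err_def)
    have "cf_B ?a (\<lambda>_. w) M \<noteq> 0"
    proof
      assume 0: "cf_B ?a (\<lambda>_. w) M = 0"
      have "(-1) ^ (2 * k) * (\<Prod>i=1..Suc (2 * k). ?a i) = 0"
        unfolding cf_casoratian[of ?a "\<lambda>_. w" "2 * k", symmetric] using 0 A by (simp add: k)
      hence "\<exists>i\<in>{1..Suc (2 * k)}. ?a i = 0" by (simp del: prod.cl_ivl_Suc)
      thus False using M_least by (auto simp: k)
    qed
    thus ?thesis using True A unfolding cf_has_value_def M_def[symmetric] by (simp add: Let_def)
  next
    case False
    have nz: "?a i \<noteq> 0" if "i \<ge> 1" for i
      using False that unfolding cf_terminates_def by (metis Suc_le_D One_nat_def)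
    have c_nz: "hcoef n d i \<noteq> 0" for i
      using nz[of "2 * i + 2"] pnum_even[of n d i] by simp
    \<comment> \<open>Beyond \<open>Suc p = 2 * n + 2\<close> every even partial numerator is \<open>hcoef n d k\<close> with \<open>k > n\<close>, hence positive.\<close>
    define p where "p = 2 * n + 1"
    define \<alpha> where "\<alpha> i = Re (?a (Suc p + i))" for i
    define C where "C = real (d * (n + 3))"
    have \<alpha>: "?a (Suc p + i) = of_real (\<alpha> i) \<and> \<alpha> i > 0 \<and> \<alpha> i \<le> real ((n + i + 1) * d)" if "i \<ge> 1" for i
    proof (cases "even i")
      case True
      then obtain k where i: "i = 2 * k" by blast
      have a: "?a (Suc p + i) = of_real (hcoef n d (n + k))"
        using pnum_even[of n d "n + k"] by (simp add: i p_def add_ac)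
      have "hcoef n d (n + k) > 0" using that i d by (intro hcoef_pos) auto
      moreover have "hcoef n d (n + k) \<le> real ((n + k + 1) * d)" by (simp add: hcoef_def)
      moreover have "(n + k + 1) * d \<le> (n + i + 1) * d" using i by (intro mult_right_mono) auto
      ultimately show ?thesis unfolding \<alpha>_def a by (auto intro: order_trans simp del: of_nat_mult)
    next
      case False
      then obtain k where i: "i = 2 * k + 1" by (elim oddE)
      have a: "?a (Suc p + i) = of_real (real ((n + k + 1) * d))"
        using pnum_odd[of "n + k + 1" n d] by (simp add: i p_def add_ac)
      have "(n + k + 1) * d \<le> (n + i + 1) * d" using i by (intro mult_right_mono) auto
      moreover have "(n + k + 1) * d > 0" using d by simp
      ultimately show ?thesis unfolding \<alpha>_def a by (auto simp del: of_nat_mult)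
    qed
    have \<alpha>_le: "\<alpha> (i + 2) \<le> C * (real i + 1)" for i
    proof -
      have "(n + (i + 2) + 1) * d \<le> d * (n + 3) * (i + 1)" by (simp add: algebra_simps)
      hence "real ((n + (i + 2) + 1) * d) \<le> real (d * (n + 3) * (i + 1))" by (simp only: of_nat_le_iff)
      also have "\<dots> = C * (real i + 1)" by (simp add: C_def algebra_simps)
      finally show ?thesis using \<alpha>[of "i + 2"] by linarith
    qed
    have C0: "C > 0" using d by (simp add: C_def)
    have alt: "\<exists>q e. q \<noteq> 0 \<and> (\<forall>i. q * (cf_A ?a (\<lambda>_. of_real u) (Suc p + i)
        - ?v (of_real u) * cf_B ?a (\<lambda>_. of_real u) (Suc p + i)) = of_real (e i) \<and> e i * e (Suc i) < (0::real))"
      if u: "u > 0" for u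
    proof -
      obtain q y where q: "q \<noteq> 0" "y > 0" "\<And>m. q * err m (of_real u) = of_real (ray_err n d G y u m)"
        using ray[OF u] c_nz by auto
      have "ray_err n d G y u (Suc p + i) * ray_err n d G y u (Suc (Suc p + i)) < 0" for i
      proof (rule ray_err_alternates[OF d G_deriv G_decay c_nz _ u q(2)])
        show "hcoef n d ((Suc p + i) div 2) > 0"
          using d by (intro hcoef_pos) (auto simp: p_def)
      qed
      thus ?thesis using q unfolding err_def
        by (intro exI[of _ q] exI[of _ "\<lambda>i. ray_err n d G y u (Suc p + i)"]) auto
    qed
    have wS: "w \<in> ?S" using w by simp
    note P = pincherle_half_plane[OF cf_limit_holomorphic nz _ _ C0 \<alpha>_le alt wS]
    show ?thesis
      unfolding cf_has_value_def using False P \<alpha> by simp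
  qed
  with lim show ?thesis by (rule that)
qed

text \<open>
  Taking \<open>w = (z / omega d j) powr (d / 2)\<close> opens or narrows the sector of half-angle \<open>pi / d\<close> to the
  right half-plane. The argument of \<open>w\<close> stays below \<open>pi / 2\<close>, so \<open>Ln\<close> undoes the exponential.
\<close>

lemma sector_half_plane:
  assumes d: "d \<ge> 1" and z: "z \<in> sector d j"
  obtains w where "Re w > 0" "z = omega d j * exp (2 / of_nat d * Ln w)" "z ^ d = w\<^sup>2" "z \<noteq> 0"
proof -
  obtain \<theta> where z0: "z \<noteq> 0" and \<theta>: "is_Arg z \<theta>" "\<bar>\<theta> - 2 * real j * pi / real d\<bar> < pi / real d"
    using z unfolding sector_def by blast
  define \<psi> where "\<psi> = \<theta> - 2 * real j * pi / real d"
  define t where "t = Complex (ln (norm z)) \<psi>"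
  define w where "w = exp (of_nat d / 2 * t)"
  have im: "Im (of_nat d / 2 * t) = real d / 2 * \<psi>" by (simp add: t_def)
  have "real d * \<bar>\<psi>\<bar> < real d * (pi / real d)"
    using \<theta>(2) d unfolding \<psi>_def by (intro mult_strict_left_mono) auto
  hence "\<bar>real d * \<psi>\<bar> < pi" using d by (simp add: abs_mult)
  hence bd: "\<bar>real d / 2 * \<psi>\<bar> < pi / 2" by (simp add: abs_mult)
  have "Re w > 0"
    unfolding w_def Re_exp im using bd by (intro mult_pos_pos cos_gt_zero_pi) auto
  moreover have Ln: "Ln w = of_nat d / 2 * t"
    unfolding w_def using bd by (intro Ln_exp) (auto simp only: im)
  have tY: "exp (2 / of_nat d * Ln w) = exp t" using d by (simp add: Ln)
  moreover have "z = omega d j * exp t"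
  proof -
    have "omega d j * exp t = exp (2 * of_real pi * \<i> * of_nat j / of_nat d + t)"
      by (simp add: omega_def exp_add)
    also have "2 * of_real pi * \<i> * of_nat j / of_nat d + t = of_real (ln (norm z)) + \<i> * of_real \<theta>"
      by (simp add: t_def \<psi>_def complex_eq_iff)
    also have "exp \<dots> = z"
      using \<theta>(1) z0 unfolding is_Arg_def by (simp add: exp_add exp_of_real)
    finally show ?thesis by simp
  qed
  moreover have "z ^ d = w\<^sup>2"
  proof -
    have "z ^ d = exp t ^ d" using calculation(3) omega_power[OF d, of j] by (simp add: power_mult_distrib)
    also have "\<dots> = exp (of_nat d * t)" by (rule exp_of_nat_mult[symmetric])
    also have "\<dots> = exp (of_nat 2 * (of_nat d / 2 * t))" by simp
    also have "\<dots> = w\<^sup>2" unfolding w_def by (rule exp_of_nat_mult)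
    finally show ?thesis .
  qed
  ultimately show ?thesis using z0 by (intro that[of w]) auto
qed

theorem mainTheorem6:
  fixes n d j :: nat and z :: complex
  assumes "d \<ge> 1" and "j \<in> {1..d}" and "z \<in> sector d j"
  shows "cf_convergent (pnum n d) (pden1 d z) \<and>
         F n d z = W n d j
           - z ^ n * exp (- (z ^ d) / of_nat d) * cf_value (pnum n d) (pden1 d z) \<and>
         cf_convergent (pnum n d) (pden2 d z) \<and>
         F n d z = W n d j
           - z ^ (n + 1) * exp (- (z ^ d) / of_nat d) * cf_value (pnum n d) (pden2 d z)"
proof -
  obtain w where w: "Re w > 0" "z = omega d j * exp (2 / of_nat d * Ln w)" "z ^ d = w\<^sup>2" "z \<noteq> 0"
    using sector_half_plane[OF assms(1,3)] .
  obtain l where l: "((\<lambda>y. F n d (of_real y)) \<longlongrightarrow> l) at_top"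
    "cf_has_value (pnum n d) (\<lambda>_. w) (cf_limit n d l w)"
    using cf_symmetric[OF assms(1), of n] w(1) by metis
  let ?v = "cf_limit n d l w" and ?y = "exp (2 / of_nat d * Ln w)" and ?\<omega> = "omega d j"
  have w0: "w \<noteq> 0" using w(1) by auto
  have "z * z ^ (d - 1) = w\<^sup>2"
    using w(3) assms(1) by (metis power_Suc Suc_diff_1 less_le_trans zero_less_one)
  hence "z ^ (d - 1) = w / z * w" using w(4) by (simp add: field_simps power2_eq_square)
  hence den1: "pden1 d z = (\<lambda>m. if odd m then w / z * w else w / (w / z))"
    using w0 w(4) by (auto simp: pden1_def fun_eq_iff)
  have den2: "pden2 d z = (\<lambda>m. if odd m then w * w else w / w)"
    using w0 w(3) by (auto simp: pden2_def fun_eq_iff power2_eq_square)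
  have val1: "cf_has_value (pnum n d) (pden1 d z) (?v / (w / z))"
    unfolding den1 using w0 w(4) by (intro cf_has_value_rescale l) auto
  have val2: "cf_has_value (pnum n d) (pden2 d z) (?v / w)"
    unfolding den2 using w0 by (intro cf_has_value_rescale l)
  have E: "exp (- (z ^ d) / of_nat d) * exp (w\<^sup>2 / of_nat d) = 1"
    unfolding w(3) exp_add[symmetric] by simp
  have "z ^ (n + 1) * exp (- (z ^ d) / of_nat d) * (?v / w)
      = (z ^ (n + 1) / ?y ^ (n + 1)) * (l - F n d ?y) * (exp (- (z ^ d) / of_nat d) * exp (w\<^sup>2 / of_nat d))"
    using w0 by (simp add: cf_limit_def)
  also have "\<dots> = ?\<omega> ^ (n + 1) * (l - F n d ?y)"
    unfolding E by (simp add: w(2) power_mult_distrib)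
  also have "\<dots> = W n d j - F n d z"
    unfolding W_eq[OF assms(1) l(1)] w(2) F_rotate[OF omega_power[OF assms(1)]]
    by (simp add: algebra_simps)
  finally have main: "z ^ (n + 1) * exp (- (z ^ d) / of_nat d) * (?v / w) = W n d j - F n d z" .
  hence "z ^ n * exp (- (z ^ d) / of_nat d) * (?v / (w / z)) = W n d j - F n d z"
    by (simp add: mult_ac)
  with main show ?thesis
    using val1 val2 unfolding cf_convergent_def cf_value_eq[OF val1] cf_value_eq[OF val2] by auto
qed

end
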